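(* Let $(P_n)$ be a sequence of finite unlabelled posets with $|P_n|\to\infty$. Then the following are equivalent: (i) $P_n\to\Pi$ in $\overline{\mathcal P}$ for some $\Pi\in\overline{\mathcal P}$; (ii) $\widehat P_n\to R$ in distribution in $\mathcal P^L_{\mathbb N}$ for some random $R\in\mathcal P^L_{\mathbb N}$. If these hold, then $R$ is exchangeable and $R\overset{d}{=}P(\infty,\Pi)$; consequently $t(Q,\Pi)=\mathbb P(R\supseteq Q)$ and $t_{\mathrm{ind}}(Q,\Pi)=\mathbb P(R|_A=Q)$ for every finite labelled poset $Q$ with ground set $A\subset\mathbb N$.
   Context: A poset is a nonempty set with a strict partial order $<$. For finite posets $Q,P$: $t(Q,P)$ is the proportion of all maps $\varphi$ from the ground set of $Q$ to that of $P$ with $x<_Qy\Rightarrow\varphi(x)<_P\varphi(y)$; $t_{\mathrm{ind}}(Q,P)$ is the proportion of injective maps with $x<_Qy\iff\varphi(x)<_P\varphi(y)$ ($0$ if $|Q|>|P|$). Let $\mathcal P$ be the set of isomorphism classes of finite nonempty posets; identify $\mathcal P$ with its (injective) image under $P\mapsto((t(Q,P))_{Q\in\mathcal P},|P|^{-1})\in[0,1]^{\mathcal P}\times[0,1]$, let $\overline{\mathcal P}$ be the closure (product topology) and $\mathcal P_\infty=\overline{\mathcal P}\setminus\mathcal P$; $t(Q,\cdot),t_{\mathrm{ind}}(Q,\cdot)$ extend continuously to $\overline{\mathcal P}$. $\mathcal P^L_{\mathbb N}$ is the set of posets on $\mathbb N$, a compact metrizable subset of $\{0,1\}^{\mathbb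 N\times\mathbb N}$ (product topology) via indicators $\mathbf 1\{i<j\}$. For a finite unlabelled poset $P$, $\widehat P$ is the random labelled poset obtained by labelling $P$ by $1,\dots,|P|$ uniformly at random (each of the $|P|!$ labellings equally likely), extended to a poset on $\mathbb N$ by adding the points $|P|+1,|P|+2,\dots$ incomparable to everything. A random poset on $\mathbb N$ is exchangeable if its law is invariant under permutations of $\mathbb N$. For a labelled poset $Q$ with ground set $A\subset\mathbb N$, $R\supseteq Q$ means $x<_Qy\Rightarrow x<_Ry$; $R|_A$ is $A$ with the order induced by $R$. An ordered probability space $(\mathcal S,\mathcal F,\mu,\prec)$ is a probability space with a strict partial order $\prec$ with $\{(x,y):x\prec y\}\in\mathcal F\times\mathcal F$; a kernel on it is a measurable $W:\mathcal S^2\to[0,1]$ with $W(x,y)>0\Rightarrow x\prec y$ and ($W(x,y)>0$, $W(y,z)>0$) $\Rightarrow W(x,z)=1$ for all $x,y,z$; $\Pi_W\in\mathcal P_\infty$ satisfies $t(Q,\Pi_W)=\int\prod_{(i,j):i<_Qj}W(x_i,x_j)\,d\mu(x_1)\cdots d\mu(x_{|Q|})$ for all $Q$. $P(\infty,W)$ is the random poset on $\mathbb N$ obtained from i.i.d. $X_i\sim\mu$ and independent i.i.d. $\xi_{ij}\sim U(0,1)$ with $i\prec j$ iff $\xi_{ij}<W(X_i,X_j)$. Every $\Pi\in\mathcal P_\infty$ equals $\Pi_W$ for some kernel, the law of $P(\infty,W)$ depends only on $\Pi_W$, and $P(\infty,\Pi)$ denotes $P(\infty,W)$ for any $W$ with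 $\Pi_W=\Pi$. *)

theory Defs
  imports "HOL-Probability.Probability"
begin

text \<open>A finite (labelled) poset is a pair (A, r): a finite nonempty ground set A of
naturals and a strict partial order r on A (r is False outside A).  Unlabelled posets
are represented by labelled representatives; all notions below are isomorphism invariant.\<close>

type_synonym fposet = "nat set \<times> (nat \<Rightarrow> nat \<Rightarrow> bool)"

definition fin_poset :: "fposet \<Rightarrow> bool" where
  "fin_poset P \<longleftrightarrow> (case P of (A, r) \<Rightarrow>
      finite A \<and> A \<noteq> {} \<and>
      (\<forall>x y. r x y \<longrightarrow> x \<in> A \<and> y \<in> A) \<and>
      (\<forall>x. \<not> r x x) \<and>
      (\<forall>x y z. r x y \<longrightarrow> r y z \<longrightarrow> r x z))"

definition hom_dens :: "fposet \<Rightarrow> fposet \<Rightarrow> real" where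
  "hom_dens Q P = (case Q of (B, q) \<Rightarrow> case P of (A, r) \<Rightarrow>
     real (card {phi \<in> B \<rightarrow>\<^sub>E A. \<forall>x\<in>B. \<forall>y\<in>B. q x y \<longrightarrow> r (phi x) (phi y)})
       / real (card (B \<rightarrow>\<^sub>E A)))"

definition ind_dens :: "fposet \<Rightarrow> fposet \<Rightarrow> real" where
  "ind_dens Q P = (case Q of (B, q) \<Rightarrow> case P of (A, r) \<Rightarrow>
     if card B > card A then 0 else
     real (card {phi \<in> B \<rightarrow>\<^sub>E A. inj_on phi B \<and>
                   (\<forall>x\<in>B. \<forall>y\<in>B. q x y \<longleftrightarrow> r (phi x) (phi y))})
       / real (card {phi \<in> B \<rightarrow>\<^sub>E A. inj_on phi B}))"

text \<open>The embedding P \<mapsto> ((t(Q,P))_Q, 1/|P|) into [0,1]^(posets) \<times> [0,1] (product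
topology); coordinates indexed by non-posets are set to 0.\<close>
definition emb :: "fposet \<Rightarrow> (fposet \<Rightarrow> real) \<times> real" where
  "emb P = ((\<lambda>Q. if fin_poset Q then hom_dens Q P else 0), 1 / real (card (fst P)))"

definition Pbar :: "((fposet \<Rightarrow> real) \<times> real) set" where
  "Pbar = closure (emb ` {P. fin_poset P})"

definition Pinf :: "((fposet \<Rightarrow> real) \<times> real) set" where
  "Pinf = Pbar - emb ` {P. fin_poset P}"

text \<open>Continuous extensions of t(Q,.) and t_ind(Q,.) to Pbar.\<close>
definition hom_dens_bar :: "fposet \<Rightarrow> (fposet \<Rightarrow> real) \<times> real \<Rightarrow> real" where
  "hom_dens_bar Q Lm = fst Lm Q"

definition ind_dens_bar :: "fposet \<Rightarrow> (fposet \<Rightarrow> real) \<times> real \<Rightarrow> real" where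
  "ind_dens_bar Q Lm =
     (if Lm \<in> emb ` {P. fin_poset P}
      then ind_dens Q (SOME P. fin_poset P \<and> emb P = Lm)
      else Lim (at Lm within emb ` {P. fin_poset P})
               (\<lambda>x. ind_dens Q (SOME P. fin_poset P \<and> emb P = x)))"

text \<open>Labelled posets on \<nat> (here HOL's nat, i.e. labels start at 0), as relations;
the ambient space {0,1}^(\<nat>\<times>\<nat>) is nat \<Rightarrow> nat \<Rightarrow> bool with the product topology.\<close>
definition PL :: "(nat \<Rightarrow> nat \<Rightarrow> bool) set" where
  "PL = {R. (\<forall>x. \<not> R x x) \<and> (\<forall>x y z. R x y \<longrightarrow> R y z \<longrightarrow> R x z)}"

text \<open>Random labelling of a finite poset P by 0..|P|-1 (uniform over all |P|! bijections),
extended by the points |P|, |P|+1, ... incomparable to everything; its law.\<close>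
definition labellings :: "fposet \<Rightarrow> (nat \<Rightarrow> nat) set" where
  "labellings P = {sg \<in> {..<card (fst P)} \<rightarrow>\<^sub>E fst P. bij_betw sg {..<card (fst P)} (fst P)}"

definition relabel :: "fposet \<Rightarrow> (nat \<Rightarrow> nat) \<Rightarrow> (nat \<Rightarrow> nat \<Rightarrow> bool)" where
  "relabel P sg = (\<lambda>i j. i < card (fst P) \<and> j < card (fst P) \<and> snd P (sg i) (sg j))"

definition hat_law :: "fposet \<Rightarrow> (nat \<Rightarrow> nat \<Rightarrow> bool) measure" where
  "hat_law P = measure_pmf (map_pmf (relabel P) (pmf_of_set (labellings P)))"

definition random_poset_law :: "(nat \<Rightarrow> nat \<Rightarrow> bool) measure \<Rightarrow> bool" where
  "random_poset_law M \<longleftrightarrow> prob_space M \<and> sets M = sets borel \<and> emeasure M PL = 1"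

definition conv_distr_PL :: "(nat \<Rightarrow> (nat \<Rightarrow> nat \<Rightarrow> bool) measure) \<Rightarrow> (nat \<Rightarrow> nat \<Rightarrow> bool) measure \<Rightarrow> bool" where
  "conv_distr_PL Ms M \<longleftrightarrow>
     (\<forall>f :: (nat \<Rightarrow> nat \<Rightarrow> bool) \<Rightarrow> real. continuous_on PL f \<longrightarrow> bounded (f ` PL) \<longrightarrow>
        (\<lambda>n. (LINT x:PL|Ms n. f x)) \<longlonglongrightarrow> (LINT x:PL|M. f x))"

definition exchangeable :: "(nat \<Rightarrow> nat \<Rightarrow> bool) measure \<Rightarrow> bool" where
  "exchangeable M \<longleftrightarrow>
     (\<forall>pm. bij pm \<longrightarrow> distr M borel (\<lambda>R i j. R (pm i) (pm j)) = M)"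

definition ordered_prob_space :: "'a measure \<Rightarrow> ('a \<Rightarrow> 'a \<Rightarrow> bool) \<Rightarrow> bool" where
  "ordered_prob_space mu prec \<longleftrightarrow> prob_space mu \<and>
     (\<forall>x\<in>space mu. \<not> prec x x) \<and>
     (\<forall>x\<in>space mu. \<forall>y\<in>space mu. \<forall>z\<in>space mu. prec x y \<longrightarrow> prec y z \<longrightarrow> prec x z) \<and>
     {(x, y). x \<in> space mu \<and> y \<in> space mu \<and> prec x y} \<in> sets (mu \<Otimes>\<^sub>M mu)"

definition is_kernel :: "'a measure \<Rightarrow> ('a \<Rightarrow> 'a \<Rightarrow> bool) \<Rightarrow> ('a \<Rightarrow> 'a \<Rightarrow> real) \<Rightarrow> bool" where
  "is_kernel mu prec W \<longleftrightarrow> ordered_prob_space mu prec \<and>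
     (\<lambda>(x, y). W x y) \<in> borel_measurable (mu \<Otimes>\<^sub>M mu) \<and>
     (\<forall>x\<in>space mu. \<forall>y\<in>space mu. 0 \<le> W x y \<and> W x y \<le> 1) \<and>
     (\<forall>x\<in>space mu. \<forall>y\<in>space mu. W x y > 0 \<longrightarrow> prec x y) \<and>
     (\<forall>x\<in>space mu. \<forall>y\<in>space mu. \<forall>z\<in>space mu. W x y > 0 \<longrightarrow> W y z > 0 \<longrightarrow> W x z = 1)"

definition Pi_W :: "'a measure \<Rightarrow> ('a \<Rightarrow> 'a \<Rightarrow> real) \<Rightarrow> (fposet \<Rightarrow> real) \<times> real" where
  "Pi_W mu W = ((\<lambda>Q. if fin_poset Q then
        (case Q of (B, q) \<Rightarrow>
           \<integral>x. (\<Prod>(i, j) \<in> {(i, j). i \<in> B \<and> j \<in> B \<and> q i j}. W (x i) (x j)) \<partial>(PiM B (\<lambda>_. mu)))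
      else 0), 0)"

definition P_inf_law :: "'a measure \<Rightarrow> ('a \<Rightarrow> 'a \<Rightarrow> real) \<Rightarrow> (nat \<Rightarrow> nat \<Rightarrow> bool) measure" where
  "P_inf_law mu W =
     distr (PiM UNIV (\<lambda>_::nat. mu) \<Otimes>\<^sub>M PiM UNIV (\<lambda>_::nat \<times> nat. uniform_measure lborel {0..1::real}))
           borel (\<lambda>(X, xi) i j. xi (i, j) < W (X i) (X j))"

end

(* A law on labelled posets is determined by the probabilities of the events that R extends a given
   finite poset Q: if prescribed relations contain no cycle, they may be replaced by their transitive
   closure, and linear combinations of the resulting cylinder indicators are dense in the continuous
   functions by Stone-Weierstrass. A random labelling of P restricts on finitely many labels to a
   uniformly random injection, so the probability that it extends Q is t(Q,P) up to O(1/|P|).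
   Convergence of all t(Q,P_n) is therefore the same as convergence in distribution; the limit law
   exists because a finitely additive measure on the clopen sets of a compact space is countably
   additive. Exchangeability and the identification with P(infinity,W) follow by comparing the same
   probabilities. *)
theory Submission
  imports Defs
begin

section \<open>Laws of random posets\<close>

text \<open>Two features of the statement shape the proof. First, \<open>ind_dens_bar\<close> at a
  limit point is a \<open>Lim\<close> along \<open>at Lm within\<close> the embedded posets, not
  along the given sequence. The convergence lemmas are therefore stated for arbitrary filters, and
  in that filter the growth of the posets has to be recovered from the coordinate
  \<open>1/|P|\<close>. Second, the event that R induces Q on A also forbids relations, so it is not
  an extension event. It is clopen, however, and weak convergence on this totally disconnected space
  controls every clopen event; the claim about induced densities needs no inclusion-exclusion. The
  error O(1/|P|) is the proportion of non-injective maps from Q to P, at most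
  \<open>|Q|^2/|P|\<close> by a union bound over pairs of points. For induced densities there is no
  error at all, since they already average over injections.\<close>

instance bool :: second_countable_topology
proof
  show "\<exists>B :: bool set set. countable B \<and> open = generate_topology B"
    \<comment> \<open>The rays of the order topology form a finite subbase. Second countability is
      what later allows Borel measurability of relation-valued maps to be checked
      coordinatewise.\<close>
    unfolding open_bool_def
    by (intro exI[of _ "range (\<lambda>a. {..<a}) \<union> range (\<lambda>a. {a<..})"] conjI refl countable_finite) simp
qed

text \<open>The library makes \<open>'a \<Rightarrow> 'b\<close> a Hausdorff space only through its metric instance, which
  Stone-Weierstrass needs here.\<close>
instantiation bool :: metric_space
begin

definition dist_bool :: "bool \<Rightarrow> bool \<Rightarrow> real" where
  "dist_bool x y = (if x = y then 0 else 1)"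

definition uniformity_bool :: "(bool \<times> bool) filter" where
  "uniformity_bool = (INF e\<in>{0 <..}. principal {(x, y). dist x y < e})"

instance
proof
  show "(uniformity :: (bool \<times> bool) filter) = (INF e\<in>{0 <..}. principal {(x, y). dist x y < e})"
    by (rule uniformity_bool_def)
  have "(uniformity :: (bool \<times> bool) filter) \<le> principal {(x, y). dist x y < 1}"
    unfolding uniformity_bool_def by (rule INF_lower) simp
  then have "\<forall>\<^sub>F (x', y) in uniformity. x' = x \<longrightarrow> y \<in> U" if "x \<in> U" for x and U :: "bool set"
    by (rule filter_leD) (use that in \<open>auto simp: eventually_principal dist_bool_def split: if_splits\<close>)
  then show "open U \<longleftrightarrow> (\<forall>x\<in>U. \<forall>\<^sub>F (x', y) in uniformity. x' = x \<longrightarrow> y \<in> U)" for U :: "bool set"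
    by (simp add: discrete_topology_class.open_discrete)
qed (auto simp: dist_bool_def)

end

section \<open>Topology and Borel sets of the space of relations\<close>

definition cyl :: "(nat \<times> nat) set \<Rightarrow> (nat \<Rightarrow> nat \<Rightarrow> bool) set" where
  "cyl S = {R. \<forall>(i, j)\<in>S. R i j}"

definition ext_event :: "nat set \<Rightarrow> (nat \<Rightarrow> nat \<Rightarrow> bool) \<Rightarrow> (nat \<Rightarrow> nat \<Rightarrow> bool) set" where
  "ext_event A q = {R. \<forall>x\<in>A. \<forall>y\<in>A. q x y \<longrightarrow> R x y}"

lemma continuous_on_rel:
  "continuous_on X (\<lambda>R :: nat \<Rightarrow> nat \<Rightarrow> bool. R i j)"
  using continuous_on_product_then_coordinatewise[OF continuous_on_product_coordinates]
  by (rule continuous_on_subset) simp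

lemma clopen_rel:
  "open {R :: nat \<Rightarrow> nat \<Rightarrow> bool. R i j = b}" "closed {R :: nat \<Rightarrow> nat \<Rightarrow> bool. R i j = b}"
proof -
  have e: "{R :: nat \<Rightarrow> nat \<Rightarrow> bool. R i j = b} = (\<lambda>R. R i j) -` {b}" by auto
  show "open {R :: nat \<Rightarrow> nat \<Rightarrow> bool. R i j = b}" unfolding e
    by (rule open_vimage[OF discrete_topology_class.open_discrete continuous_on_rel])
  show "closed {R :: nat \<Rightarrow> nat \<Rightarrow> bool. R i j = b}"
    by (rule closed_Collect_eq[OF continuous_on_rel continuous_on_const])
qed

lemma closed_PL: "closed PL"
proof -
  have "PL = (\<Inter>x. {R. R x x = False}) \<inter>
    (\<Inter>x y z. {R. R x y = False} \<union> {R. R y z = False} \<union> {R. R x z = True})"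
    by (auto simp: PL_def)
  also have "closed \<dots>"
    by (intro closed_Int closed_INT closed_Un clopen_rel ballI)
  finally show ?thesis .
qed

lemma cyl_INT: "cyl S = (\<Inter>p\<in>S. {R. R (fst p) (snd p) = True})"
  by (auto simp: cyl_def case_prod_unfold)

lemma open_cyl: "finite S \<Longrightarrow> open (cyl S)"
  unfolding cyl_INT by (intro open_INT ballI clopen_rel) simp

lemma closed_cyl: "closed (cyl S)"
  unfolding cyl_INT by (intro closed_INT ballI clopen_rel)

lemma borel_cyl: "finite S \<Longrightarrow> cyl S \<in> sets borel"
  by (intro borel_open open_cyl)

text \<open>Tychonoff's theorem, stated for one function space because relations are curried: it is
  applied twice to reach \<open>nat \<Rightarrow> nat \<Rightarrow> bool\<close>.\<close>

lemma compact_UNIV_fun: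
  assumes "compact (UNIV :: 'b::topological_space set)"
  shows "compact (UNIV :: ('a \<Rightarrow> 'b) set)"
proof -
  have "compact_space (euclidean :: 'b topology)"
    using assms by (simp add: compact_space_def)
  hence "compact_space (product_topology (\<lambda>_::'a. euclidean :: 'b topology) UNIV)"
    by (subst compact_space_product_topology) blast
  thus ?thesis
    by (simp add: euclidean_product_topology compact_space_def)
qed

lemma compact_UNIV_rel: "compact (UNIV :: (nat \<Rightarrow> nat \<Rightarrow> bool) set)"
  by (intro compact_UNIV_fun finite_imp_compact) simp

lemma compact_PL: "compact PL"
  using compact_Int_closed[OF compact_UNIV_rel closed_PL] by simp

text \<open>Cylinders that only require relations, and never forbid any, suffice: complements supply
  the negative constraints. This keeps the generator stable under intersection and close to
  homomorphism counts.\<close>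

lemma borel_rel_eq_sigma_cyl:
  "sets (borel :: (nat \<Rightarrow> nat \<Rightarrow> bool) measure) = sigma_sets UNIV {cyl S | S. finite S}"
proof
  let ?M = "sigma UNIV {cyl S | S. finite S} :: (nat \<Rightarrow> nat \<Rightarrow> bool) measure"
  have b: "(\<lambda>R. R i j) \<in> borel_measurable ?M" for i j
  proof -
    have T: "{R. R i j} \<in> sets ?M"
      by (subst sets_measure_of) (auto intro!: sigma_sets.Basic exI[of _ "{(i,j)}"] simp: cyl_def)
    have p: "(\<lambda>R. R i j) \<in> ?M \<rightarrow>\<^sub>M count_space UNIV"
      using T by (simp add: pred_def space_measure_of_conv)
    show ?thesis
      by (intro measurableI) (use measurable_sets[OF p] in auto)
  qed
  \<comment> \<open>Measurability of the identity from the cylinder sigma-algebra to the Borel one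
    is the wanted inclusion, and it can be tested on single coordinates.\<close>
  have "(\<lambda>x. x) \<in> borel_measurable ?M"
    by (intro measurable_coordinatewise_then_product b)
  from measurable_sets[OF this] have "sets borel \<subseteq> sets ?M"
    by (auto simp: space_measure_of_conv)
  then show "sets borel \<subseteq> sigma_sets UNIV {cyl S | S. finite S}"
    by (simp add: sets_measure_of)
  show "sigma_sets UNIV {cyl S | S. finite S} \<subseteq> sets (borel :: (nat \<Rightarrow> nat \<Rightarrow> bool) measure)"
    by (intro sets.sigma_sets_subset[of _ borel, simplified]) (auto intro: borel_cyl)
qed

lemma Int_cyl: "cyl S \<inter> cyl T = cyl (S \<union> T)"
  by (auto simp: cyl_def)

lemma measurable_relI:
  fixes f :: "'a \<Rightarrow> nat \<Rightarrow> nat \<Rightarrow> bool"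
  assumes "\<And>i j. {x\<in>space N. f x i j} \<in> sets N"
  shows "f \<in> borel_measurable N"
proof (rule measurable_sigma_sets[OF borel_rel_eq_sigma_cyl])
  fix X assume "X \<in> {cyl S | S. finite S}"
  then obtain S where S: "X = cyl S" "finite S" by auto
  have "f -` X \<inter> space N = {x\<in>space N. \<forall>p\<in>S. f x (fst p) (snd p)}"
    by (auto simp: S cyl_def)
  also have "\<dots> \<in> sets N" using assms S by (intro sets.sets_Collect_finite_All)
  finally show "f -` X \<inter> space N \<in> sets N" .
qed auto

text \<open>Inclusion of the Borel sets, rather than equality, admits \<open>hat_law\<close>: as the
  measure of a pmf it has every subset measurable. Finite labellings and Borel limit laws can then
  be compared by the same lemmas.\<close>

definition poset_law :: "(nat \<Rightarrow> nat \<Rightarrow> bool) measure \<Rightarrow> bool" where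
  "poset_law N \<longleftrightarrow> prob_space N \<and> sets borel \<subseteq> sets N \<and> space N = UNIV \<and> measure N PL = 1"

lemma random_poset_law_iff: "random_poset_law M \<longleftrightarrow> poset_law M \<and> sets M = sets borel"
proof -
  have "space M = UNIV" if "sets M = sets borel"
    using sets_eq_imp_space_eq[OF that] by simp
  moreover have "emeasure M PL = 1 \<longleftrightarrow> measure M PL = 1" if "prob_space M"
    using that by (simp add: finite_measure.emeasure_eq_measure prob_space_def)
  ultimately show ?thesis
    unfolding random_poset_law_def poset_law_def by blast
qed

lemma poset_lawD:
  assumes "poset_law N"
  shows "prob_space N" "space N = UNIV" "measure N PL = 1" "\<And>X. X \<in> sets borel \<Longrightarrow> X \<in> sets N"
    "AE R in N. R \<in> PL"
proof -
  show p: "prob_space N" "space N = UNIV" "measure N PL = 1" "\<And>X. X \<in> sets borel \<Longrightarrow> X \<in> sets N"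
    using assms by (auto simp: poset_law_def)
  show "AE R in N. R \<in> PL"
    using p closed_PL by (intro prob_space.AE_prob_1) auto
qed

section \<open>Cylinders restricted to posets, and uniqueness of poset laws\<close>

lemma in_PL_trancl:
  assumes "R \<in> PL" "R \<in> cyl S" "(x, y) \<in> S\<^sup>+" shows "R x y"
  using assms(3)
proof induction
  case (base y)
  then show ?case using assms(2) by (auto simp: cyl_def)
next
  case (step y z)
  have "R y z" using assms(2) step by (auto simp: cyl_def)
  with step assms(1) show ?case unfolding PL_def by blast
qed

text \<open>The relation \<open>q\<close> is the transitive closure of \<open>S\<close>.\<close>
lemma cyl_cases:
  assumes "finite S"
  obtains (cycle) "\<And>R. R \<in> PL \<Longrightarrow> R \<notin> cyl S"
    | (poset) A q where "fin_poset (A, q)" "\<And>R. R \<in> PL \<Longrightarrow> R \<in> cyl S \<longleftrightarrow> R \<in> ext_event A q"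
proof (cases "\<exists>x. (x, x) \<in> S\<^sup>+")
  case True
  then show ?thesis using in_PL_trancl cycle by (metis (mono_tags, lifting) PL_def mem_Collect_eq)
next
  case False
  \<comment> \<open>Ground sets must be nonempty; the point 0 covers the case of an empty
    \<open>S\<close>.\<close>
  define A where "A = insert 0 (fst ` S \<union> snd ` S)"
  define q where "q x y \<longleftrightarrow> (x, y) \<in> S\<^sup>+" for x y
  have "S \<subseteq> A \<times> A" by (force simp: A_def)
  hence SA: "S\<^sup>+ \<subseteq> A \<times> A" by (rule trancl_subset_Sigma)
  show ?thesis
  proof (rule poset)
    have "finite A" using assms by (simp add: A_def)
    moreover have "q x y \<Longrightarrow> x \<in> A \<and> y \<in> A" "q x y \<Longrightarrow> q y z \<Longrightarrow> q x z" for x y z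
      using SA by (auto simp: q_def)
    ultimately show "fin_poset (A, q)"
      using False unfolding fin_poset_def q_def prod.case by (auto simp: A_def)
    show "R \<in> cyl S \<longleftrightarrow> R \<in> ext_event A q" if "R \<in> PL" for R
    proof
      show "R \<in> cyl S \<Longrightarrow> R \<in> ext_event A q"
        using in_PL_trancl[OF that, of S] by (simp add: ext_event_def q_def)
      show "R \<in> ext_event A q \<Longrightarrow> R \<in> cyl S"
        using SA by (auto simp: ext_event_def cyl_def q_def)
    qed
  qed
qed

lemma ext_event_cyl: "ext_event A q = cyl {(x, y). x \<in> A \<and> y \<in> A \<and> q x y}"
  by (auto simp: cyl_def ext_event_def)

lemma finite_ext: "finite A \<Longrightarrow> finite {(x, y). x \<in> A \<and> y \<in> A \<and> q x y}"
  by (rule finite_subset[of _ "A \<times> A"]) auto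

lemma fin_poset_finite: "fin_poset (A, q) \<Longrightarrow> finite A"
  by (simp add: fin_poset_def)

lemma poset_law_measure_cong:
  assumes "poset_law N" "A \<in> sets borel" "B \<in> sets borel" "\<And>R. R \<in> PL \<Longrightarrow> R \<in> A \<longleftrightarrow> R \<in> B"
  shows "measure N A = measure N B"
proof -
  interpret prob_space N using poset_lawD[OF assms(1)] by simp
  show ?thesis using poset_lawD[OF assms(1)] assms
    by (intro finite_measure_eq_AE) auto
qed

lemma borel_ext_event: "finite A \<Longrightarrow> ext_event A q \<in> sets borel"
  unfolding ext_event_cyl by (intro borel_cyl finite_ext)

text \<open>Uniqueness uses the pi-system of cylinders instead of density. A cyclic cylinder
  contains no poset and has measure 0 under both laws; any other agrees on \<open>PL\<close> with an
  extension event.\<close>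

lemma poset_law_eqI:
  assumes N: "poset_law N" "sets N = sets borel" and N': "poset_law N'" "sets N' = sets borel"
  assumes eq: "\<And>A q. fin_poset (A, q) \<Longrightarrow> measure N (ext_event A q) = measure N' (ext_event A q)"
  shows "N = N'"
proof -
  interpret N: prob_space N using poset_lawD[OF N(1)] by simp
  interpret N': prob_space N' using poset_lawD[OF N'(1)] by simp
  have eq': "measure N (cyl S) = measure N' (cyl S)" if S: "finite S" for S
  using S
  proof (cases rule: cyl_cases)
    case cycle
    have "measure K (cyl S) = measure K {}" if "poset_law K" for K
      using cycle S by (intro poset_law_measure_cong[OF that]) (auto intro: borel_cyl)
    then show ?thesis using N N' by simp
  next
    case (poset A q)
    have "measure K (cyl S) = measure K (ext_event A q)" if "poset_law K" for K
      using poset S by (intro poset_law_measure_cong[OF that])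
        (auto intro: borel_cyl borel_ext_event fin_poset_finite)
    then show ?thesis using N N' eq poset by simp
  qed
  show ?thesis
  proof (rule measure_eqI_generator_eq[of "{cyl S |S. finite S}" UNIV _ _ "\<lambda>_. UNIV"])
    show "Int_stable {cyl S |S. finite S}"
      unfolding Int_stable_def by (auto simp: Int_cyl)
    show "sets N = sigma_sets UNIV {cyl S |S. finite S}" "sets N' = sigma_sets UNIV {cyl S |S. finite S}"
      using N N' by (simp_all add: borel_rel_eq_sigma_cyl)
    show "range (\<lambda>_. UNIV) \<subseteq> {cyl S |S. finite S}"
      by (auto intro!: exI[of _ "{}"] simp: cyl_def)
  qed (use eq' in \<open>auto simp: N.emeasure_eq_measure N'.emeasure_eq_measure\<close>)
qed

lemma poset_law_measurable:
  assumes "poset_law N" "f \<in> borel_measurable borel" shows "f \<in> borel_measurable N"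
  using measurable_sets[OF assms(2)] poset_lawD[OF assms(1)] by (intro measurableI) auto

text \<open>Compactness of \<open>PL\<close> makes \<open>f\<close> bounded there, and closedness of
  \<open>PL\<close> makes its extension by zero measurable.\<close>

lemma poset_law_set_integrable:
  fixes f :: "(nat \<Rightarrow> nat \<Rightarrow> bool) \<Rightarrow> real"
  assumes N: "poset_law N" and f: "continuous_on PL f"
  shows "set_integrable N PL f"
proof -
  interpret prob_space N using poset_lawD[OF N] by simp
  have "(\<lambda>x. indicator PL x *\<^sub>R f x) \<in> borel_measurable N"
    by (intro poset_law_measurable[OF N] borel_measurable_continuous_on_indicator f borel_closed closed_PL)
  moreover obtain B where B: "\<And>x. x \<in> PL \<Longrightarrow> \<bar>f x\<bar> \<le> B"
    using compact_imp_bounded[OF compact_continuous_image[OF f compact_PL]]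
    by (force simp: bounded_iff)
  have "norm (indicator PL x *\<^sub>R f x) \<le> max 0 B" for x
    using B[of x] by (auto simp: indicator_def)
  ultimately show ?thesis unfolding set_integrable_def
    by (intro integrable_const_bound[of _ "max 0 B"]) auto
qed

lemma poset_law_integral_close:
  fixes f g :: "(nat \<Rightarrow> nat \<Rightarrow> bool) \<Rightarrow> real"
  assumes N: "poset_law N" and f: "continuous_on PL f" and g: "continuous_on PL g"
    and e: "e \<ge> 0" "\<And>x. x \<in> PL \<Longrightarrow> \<bar>f x - g x\<bar> \<le> e"
  shows "\<bar>(LINT x:PL|N. f x) - (LINT x:PL|N. g x)\<bar> \<le> e"
proof -
  interpret prob_space N using poset_lawD[OF N] by simp
  have i: "set_integrable N PL (\<lambda>x. f x - g x)"
    by (intro poset_law_set_integrable[OF N] continuous_intros f g)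
  have "(LINT x:PL|N. f x) - (LINT x:PL|N. g x) = (LINT x:PL|N. f x - g x)"
    by (intro set_integral_diff(2)[symmetric] poset_law_set_integrable[OF N] f g)
  also have "\<bar>\<dots>\<bar> \<le> (\<integral>x. \<bar>indicator PL x *\<^sub>R (f x - g x)\<bar> \<partial>N)"
    unfolding set_lebesgue_integral_def by (rule integral_abs_bound)
  also have "\<dots> \<le> (\<integral>x. e \<partial>N)"
    using i e by (intro integral_mono) (auto simp: set_integrable_def indicator_def)
  finally show ?thesis by (simp add: prob_space)
qed

lemma poset_law_integral_indicator:
  assumes N: "poset_law N" and X: "X \<in> sets borel"
  shows "(LINT x:PL|N. indicator X x) = measure N X"
proof -
  interpret prob_space N using poset_lawD[OF N] by simp
  have "(LINT x:PL|N. indicator X x) = measure N (PL \<inter> X)"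
    using poset_lawD[OF N] by (simp add: set_lebesgue_integral_def indicator_inter_arith[symmetric])
  also have "\<dots> = measure N X"
    using X closed_PL by (intro poset_law_measure_cong[OF N]) auto
  finally show ?thesis .
qed

section \<open>Approximation by cylinder combinations, and weak convergence\<close>

inductive_set cyl_combinations :: "((nat \<Rightarrow> nat \<Rightarrow> bool) \<Rightarrow> real) set" where
  monomial: "finite S \<Longrightarrow> (\<lambda>R. c * indicator (cyl S) R) \<in> cyl_combinations"
| add: "f \<in> cyl_combinations \<Longrightarrow> g \<in> cyl_combinations \<Longrightarrow> (\<lambda>R. f R + g R) \<in> cyl_combinations"

text \<open>A product of cylinder indicators is the indicator of the cylinder over the union, so the
  linear span is already an algebra.\<close>

lemma cyl_combinations_mult:
  assumes "f \<in> cyl_combinations" "g \<in> cyl_combinations"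
  shows "(\<lambda>R. f R * g R) \<in> cyl_combinations"
  using assms
proof (induction f)
  case (monomial S c)
  from monomial(2,1) show ?case
  proof (induction g)
    case (monomial T d)
    have "(\<lambda>R. (c * indicator (cyl S) R) * (d * indicator (cyl T) R) :: real) =
        (\<lambda>R. (c * d) * indicator (cyl (S \<union> T)) R)"
      by (simp add: Int_cyl[symmetric] indicator_inter_arith fun_eq_iff)
    then show ?case using monomial by (simp only:) (intro cyl_combinations.monomial, simp)
  next
    case (add g h)
    then show ?case by (simp add: distrib_left cyl_combinations.add)
  qed
next
  case (add f h)
  then show ?case by (simp add: distrib_right cyl_combinations.add)
qed

lemma continuous_on_indicator_clopen:
  assumes "open X" "closed X"
  shows "continuous_on A (indicator X :: _ \<Rightarrow> real)"
proof -
  have "continuous_on (X \<union> - X) (\<lambda>x. if x \<in> X then 1 else 0 :: real)"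
    using assms by (intro continuous_on_cases continuous_intros) auto
  then show ?thesis
    by (rule continuous_on_subset[OF continuous_on_eq]) (auto simp: indicator_def)
qed

lemma cyl_combinations_continuous:
  "f \<in> cyl_combinations \<Longrightarrow> continuous_on A f"
  by (induction f rule: cyl_combinations.induct)
    (auto intro!: continuous_intros continuous_on_indicator_clopen open_cyl closed_cyl)

text \<open>The hypotheses of Stone-Weierstrass: the empty cylinder supplies the constants, and a
  pair \<open>(i, j)\<close> on which two relations differ supplies a separating function.\<close>

interpretation cyl_ring: function_ring_on cyl_combinations PL
proof
  show "compact PL" by (rule compact_PL)
  show "(\<lambda>_. c) \<in> cyl_combinations" for c
    using cyl_combinations.monomial[of "{}" c] by (simp add: cyl_def)
  fix R R' :: "nat \<Rightarrow> nat \<Rightarrow> bool" assume "R \<noteq> R'"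
  then obtain i j where "R i j \<noteq> R' i j" by (auto simp: fun_eq_iff)
  then show "\<exists>f\<in>cyl_combinations. f R \<noteq> f R'"
    using cyl_combinations.monomial[of "{(i, j)}" 1]
    by (intro bexI[of _ "\<lambda>R. 1 * indicator (cyl {(i, j)}) R"]) (auto simp: cyl_def indicator_def)
qed (auto intro: cyl_combinations_continuous cyl_combinations.add cyl_combinations_mult)

text \<open>Two families of laws are compared, rather than a family with its limit, so that the same
  statement also yields Cauchy sequences when the limit law is not yet available.\<close>
lemma poset_law_integral_diff_tendsto_0:
  fixes N N' :: "'i \<Rightarrow> (nat \<Rightarrow> nat \<Rightarrow> bool) measure"
  assumes N: "\<forall>\<^sub>F i in F. poset_law (N i)" and N': "\<forall>\<^sub>F i in F. poset_law (N' i)"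
    and lim: "\<And>A q. fin_poset (A, q) \<Longrightarrow>
      ((\<lambda>i. measure (N i) (ext_event A q) - measure (N' i) (ext_event A q)) \<longlongrightarrow> 0) F"
    and f: "continuous_on PL f"
  shows "((\<lambda>i. (LINT x:PL|N i. f x) - (LINT x:PL|N' i. f x)) \<longlongrightarrow> (0::real)) F"
proof -
  have cyl: "((\<lambda>i. measure (N i) (cyl S) - measure (N' i) (cyl S)) \<longlongrightarrow> 0) F" if S: "finite S" for S
    using S
  proof (cases rule: cyl_cases)
    case cycle
    have e: "measure K (cyl S) = measure K {}" if "poset_law K" for K
      using cycle S by (intro poset_law_measure_cong[OF that]) (auto intro: borel_cyl)
    have "\<forall>\<^sub>F i in F. measure (N i) (cyl S) - measure (N' i) (cyl S) = 0"
      using N N' by eventually_elim (simp add: e)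
    then show ?thesis by (rule tendsto_eventually)
  next
    case (poset A q)
    have e: "measure K (cyl S) = measure K (ext_event A q)" if "poset_law K" for K
      using poset S by (intro poset_law_measure_cong[OF that])
        (auto intro: borel_cyl borel_ext_event fin_poset_finite)
    have "\<forall>\<^sub>F i in F. measure (N i) (ext_event A q) - measure (N' i) (ext_event A q) =
        measure (N i) (cyl S) - measure (N' i) (cyl S)"
      using N N' by eventually_elim (simp add: e)
    from tendsto_cong[OF this] lim[OF poset(1)] show ?thesis by simp
  qed
  have comb: "((\<lambda>i. (LINT x:PL|N i. g x) - (LINT x:PL|N' i. g x)) \<longlongrightarrow> 0) F"
    if "g \<in> cyl_combinations" for g
    using that
  proof induction
    case (monomial S c)
    have "\<forall>\<^sub>F i in F. c * (measure (N i) (cyl S) - measure (N' i) (cyl S)) =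
       (LINT x:PL|N i. c * indicator (cyl S) x) - (LINT x:PL|N' i. c * indicator (cyl S) x)"
      using N N' by eventually_elim (simp add: right_diff_distrib poset_law_integral_indicator[OF _ borel_cyl[OF monomial]])
    with tendsto_mult_right_zero[OF cyl[OF monomial], of c] show ?case
      by (rule Lim_transform_eventually)
  next
    case (add g h)
    have e: "(LINT x:PL|K. g x + h x) = (LINT x:PL|K. g x) + (LINT x:PL|K. h x)" if "poset_law K" for K
      by (intro set_integral_add(2) poset_law_set_integrable[OF that] cyl_combinations_continuous add)
    have "\<forall>\<^sub>F i in F. ((LINT x:PL|N i. g x) - (LINT x:PL|N' i. g x)) +
        ((LINT x:PL|N i. h x) - (LINT x:PL|N' i. h x)) =
        (LINT x:PL|N i. g x + h x) - (LINT x:PL|N' i. g x + h x)"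
      using N N' by eventually_elim (simp add: e)
    from tendsto_cong[OF this] tendsto_add[OF add.IH] show ?case by simp
  qed
  show ?thesis
  proof (rule tendstoI)
    fix e :: real assume "e > 0"
    then obtain g where g: "g \<in> cyl_combinations" "\<And>x. x \<in> PL \<Longrightarrow> \<bar>f x - g x\<bar> < e / 3"
      using cyl_ring.Stone_Weierstrass_basic[OF f, of "e / 3"] by auto
    \<comment> \<open>The uniform error on \<open>PL\<close> bounds the integral error for every
      poset law at once, hence uniformly in \<open>i\<close>. One third of \<open>e\<close> is spent
      under \<open>N i\<close>, one under \<open>N' i\<close>, and the last on the convergence for
      \<open>g\<close>.\<close>
    have close: "\<bar>(LINT x:PL|K. f x) - (LINT x:PL|K. g x)\<bar> \<le> e / 3" if "poset_law K" for K
      using g \<open>e > 0\<close> by (intro poset_law_integral_close[OF that f] cyl_combinations_continuous) (auto intro: less_imp_le)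
    have "\<forall>\<^sub>F i in F. dist ((LINT x:PL|N i. g x) - (LINT x:PL|N' i. g x)) 0 < e / 3"
      using \<open>e > 0\<close> by (intro tendstoD[OF comb[OF g(1)]]) simp
    with N N' show "\<forall>\<^sub>F i in F. dist ((LINT x:PL|N i. f x) - (LINT x:PL|N' i. f x)) 0 < e"
    proof eventually_elim
      case (elim i)
      with close[OF elim(1)] close[OF elim(2)] show ?case
        unfolding dist_real_def by linarith
    qed
  qed
qed

lemma poset_law_integral_tendsto:
  fixes f :: "(nat \<Rightarrow> nat \<Rightarrow> bool) \<Rightarrow> real"
  assumes N: "\<forall>\<^sub>F i in F. poset_law (N i)" and M: "poset_law M"
    and lim: "\<And>A q. fin_poset (A, q) \<Longrightarrow>
      ((\<lambda>i. measure (N i) (ext_event A q)) \<longlongrightarrow> measure M (ext_event A q)) F"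
    and f: "continuous_on PL f"
  shows "((\<lambda>i. LINT x:PL|N i. f x) \<longlongrightarrow> (LINT x:PL|M. f x)) F"
proof (rule Lim_null[THEN iffD2])
  show "((\<lambda>i. (LINT x:PL|N i. f x) - (LINT x:PL|M. f x)) \<longlongrightarrow> 0) F"
    using lim by (intro poset_law_integral_diff_tendsto_0[OF N _ _ f] always_eventually allI M)
      (simp add: Lim_null[symmetric])
qed

text \<open>Indicators of clopen sets are continuous test functions. Extension probabilities thus
  also control events that prescribe non-relations, as needed for induced densities.\<close>

lemma clopen_measure_tendsto:
  assumes N: "\<forall>\<^sub>F i in F. poset_law (N i)" and M: "poset_law M"
    and lim: "\<And>A q. fin_poset (A, q) \<Longrightarrow>
      ((\<lambda>i. measure (N i) (ext_event A q)) \<longlongrightarrow> measure M (ext_event A q)) F"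
    and X: "open X" "closed X"
  shows "((\<lambda>i. measure (N i) X) \<longlongrightarrow> measure M X) F"
proof -
  have "\<forall>\<^sub>F i in F. (LINT x:PL|N i. indicator X x) = measure (N i) X"
    using N by eventually_elim (simp add: poset_law_integral_indicator X)
  from tendsto_cong[OF this]
    poset_law_integral_tendsto[OF N M lim continuous_on_indicator_clopen[OF X]]
  show ?thesis by (simp add: poset_law_integral_indicator M X)
qed

text \<open>The limit measure is built on all relations, where clopen sets form an algebra. A
  decreasing sequence of clopen sets with empty intersection is eventually empty by compactness,
  which gives the continuity at the empty set that Caratheodory's theorem asks for. Concentration on
  \<open>PL\<close> does not pass to the limit directly, since \<open>PL\<close> is closed but not
  open; instead its complement is a countable union of clopen sets, each of limit mass 0.\<close>

lemma poset_law_exists_limit: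
  assumes N: "\<And>n. poset_law (N n)"
    and conv: "\<And>A q. fin_poset (A, q) \<Longrightarrow> convergent (\<lambda>n::nat. measure (N n) (ext_event A q))"
  obtains M where "random_poset_law M"
    "\<And>A q. fin_poset (A, q) \<Longrightarrow> (\<lambda>n. measure (N n) (ext_event A q)) \<longlonglongrightarrow> measure M (ext_event A q)"
proof -
  define C where "C = {X :: (nat \<Rightarrow> nat \<Rightarrow> bool) set. open X \<and> closed X}"
  define m where "m X = lim (\<lambda>n. measure (N n) X)" for X
  have C_borel: "C \<subseteq> sets borel" by (auto simp: C_def)
  have m: "(\<lambda>n. measure (N n) X) \<longlonglongrightarrow> m X" if X: "X \<in> C" for X
  proof -
    have c: "continuous_on PL (indicator X :: _ \<Rightarrow> real)"
      using X by (intro continuous_on_indicator_clopen) (auto simp: C_def)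
    have "((\<lambda>p. (LINT x:PL|N (fst p). indicator X x) - (LINT x:PL|N (snd p). indicator X x)) \<longlongrightarrow> (0::real))
      (sequentially \<times>\<^sub>F sequentially)"
    proof (rule poset_law_integral_diff_tendsto_0[OF _ _ _ c])
      fix A q assume "fin_poset (A, q)"
      from conv[OF this] obtain L where L: "(\<lambda>n. measure (N n) (ext_event A q)) \<longlonglongrightarrow> L"
        by (auto simp: convergent_def)
      have "((\<lambda>p. measure (N (fst p)) (ext_event A q) - measure (N (snd p)) (ext_event A q)) \<longlongrightarrow> L - L)
          (sequentially \<times>\<^sub>F sequentially)"
        by (intro tendsto_diff filterlim_compose[OF L] filterlim_fst filterlim_snd)
      then show "((\<lambda>p. measure (N (fst p)) (ext_event A q) - measure (N (snd p)) (ext_event A q)) \<longlongrightarrow> 0)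
          (sequentially \<times>\<^sub>F sequentially)" by simp
    qed (auto simp: N)
    then have *: "((\<lambda>p. measure (N (fst p)) X - measure (N (snd p)) X) \<longlongrightarrow> 0) (sequentially \<times>\<^sub>F sequentially)"
      using X C_borel by (subst (asm) (1 2) poset_law_integral_indicator[OF N]) auto
    \<comment> \<open>Differences tending to 0 along the product filter are the Cauchy property, so
      \<open>m X\<close> is a genuine limit.\<close>
    have "Cauchy (\<lambda>n. measure (N n) X)"
    proof (rule metric_CauchyI)
      fix e :: real assume "0 < e"
      from tendstoD[OF * this] obtain K where "\<And>i j. i \<ge> K \<Longrightarrow> j \<ge> K \<Longrightarrow> \<bar>measure (N i) X - measure (N j) X\<bar> < e"
        by (auto simp: eventually_prod_sequentially)
      then show "\<exists>K. \<forall>i\<ge>K. \<forall>j\<ge>K. dist (measure (N i) X) (measure (N j) X) < e"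
        by (auto simp: dist_real_def)
    qed
    then show ?thesis
      by (simp add: m_def convergent_LIMSEQ_iff[symmetric] Cauchy_convergent_iff)
  qed
  interpret algebra UNIV C
    unfolding algebra_iff_Un by (auto simp: C_def Compl_eq_Diff_UNIV[symmetric])
  have m_nonneg: "m X \<ge> 0" if "X \<in> C" for X
    by (rule LIMSEQ_le_const[OF m[OF that]]) simp
  have m_Un: "m (X \<union> Y) = m X + m Y" if XY: "X \<in> C" "Y \<in> C" "X \<inter> Y = {}" for X Y
  proof (rule LIMSEQ_unique[OF m])
    have "measure (N n) (X \<union> Y) = measure (N n) X + measure (N n) Y" for n
    proof -
      interpret prob_space "N n" using poset_lawD[OF N] by simp
      show ?thesis using XY C_borel poset_lawD[OF N] by (intro finite_measure_Union) auto
    qed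
    then show "(\<lambda>n. measure (N n) (X \<union> Y)) \<longlonglongrightarrow> m X + m Y"
      using tendsto_add[OF m[OF XY(1)] m[OF XY(2)]] by simp
  qed (use XY in auto)
  have m_const: "m X = c" if "X \<in> C" "\<And>n. measure (N n) X = c" for X c
    using LIMSEQ_unique[OF m[OF that(1)], of c] that(2) by simp
  have m_empty: "m {} = 0" by (intro m_const) auto
  have "\<exists>\<mu> :: _ \<Rightarrow> ennreal. (\<forall>X\<in>C. \<mu> X = ennreal (m X)) \<and> measure_space UNIV (sigma_sets UNIV C) \<mu>"
  proof (rule caratheodory_empty_continuous)
    show "positive C (\<lambda>X. ennreal (m X))" by (simp add: positive_def m_empty)
    show "additive C (\<lambda>X. ennreal (m X))"
      by (auto simp: additive_def m_Un m_nonneg)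
    fix A :: "nat \<Rightarrow> _" assume A: "range A \<subseteq> C" "decseq A" "(\<Inter>i. A i) = {}"
    have "\<exists>k. A k = {}"
    proof (rule ccontr)
      assume *: "\<nexists>k. A k = {}"
      have "UNIV \<inter> (\<Inter>i. A i) \<noteq> {}"
      proof (rule compact_imp_fip_image[OF compact_UNIV_rel])
        show "closed (A i)" for i using A by (auto simp: C_def)
        fix I :: "nat set" assume "finite I"
        \<comment> \<open>The member of largest index lies in all the others;
          \<open>insert 0\<close> gives \<open>Max\<close> a value when \<open>I\<close> is
          empty.\<close>
        then have "A (Max (insert 0 I)) \<subseteq> (\<Inter>i\<in>I. A i)"
          using A(2) by (intro INT_greatest) (auto simp: decseq_def)
        then show "UNIV \<inter> (\<Inter>i\<in>I. A i) \<noteq> {}" using * by blast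
      qed
      with A show False by simp
    qed
    then obtain k where "A k = {}" ..
    then have "\<forall>\<^sub>F i in sequentially. A i = {}"
      using A(2) by (intro eventually_sequentiallyI[of k]) (auto simp: decseq_def)
    then have "\<forall>\<^sub>F i in sequentially. ennreal (m (A i)) = 0"
      by eventually_elim (simp add: m_empty)
    then show "(\<lambda>i. ennreal (m (A i))) \<longlonglongrightarrow> 0" by (rule tendsto_eventually)
  qed simp
  then obtain \<mu> :: "_ \<Rightarrow> ennreal" where \<mu>: "\<And>X. X \<in> C \<Longrightarrow> \<mu> X = ennreal (m X)"
    and ms: "measure_space UNIV (sigma_sets UNIV C) \<mu>" by blast
  have cylC: "cyl S \<in> C" if "finite S" for S
    using that by (simp add: C_def open_cyl closed_cyl)
  \<comment> \<open>Every cylinder over a finite set is clopen, so the clopen sets generate the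
    Borel sets.\<close>
  have sets_C: "sigma_sets UNIV C = sets borel"
  proof
    show "sigma_sets UNIV C \<subseteq> sets borel"
      using sets.sigma_sets_subset[OF C_borel] by simp
    show "sets borel \<subseteq> sigma_sets UNIV C"
      unfolding borel_rel_eq_sigma_cyl using cylC by (intro sigma_sets_mono') auto
  qed
  define M where "M = measure_of UNIV (sets borel) \<mu>"
  have sM: "sets M = sets borel" and spM: "space M = UNIV"
    by (simp_all add: M_def sets_measure_of_conv space_measure_of_conv sets.sigma_sets_eq[of borel, simplified])
  have eM: "emeasure M X = ennreal (m X)" if "X \<in> C" for X
    using ms that C_borel \<mu> unfolding M_def sets_C measure_space_def
    by (subst emeasure_measure_of_sigma) auto
  have mM: "measure M X = m X" if "X \<in> C" for X
    using eM[OF that] m_nonneg[OF that] by (simp add: measure_def)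
  have "m UNIV = 1"
    using poset_lawD(1,2)[OF N] prob_space.prob_space[of "N _"] by (intro m_const) simp_all
  then have M: "prob_space M"
    using eM[of UNIV] spM by (intro prob_spaceI) auto
  interpret prob_space M by fact
  \<comment> \<open>A clopen set that misses \<open>PL\<close> has measure 0 under every
    \<open>N n\<close>, hence in the limit. The failures of irreflexivity at \<open>x\<close>, and
    of transitivity at \<open>x\<close>, \<open>y\<close>, \<open>z\<close>, are such sets.\<close>
  have null: "AE R in M. R \<notin> X" if X: "X \<in> C" "X \<inter> PL = {}" for X
  proof -
    have "measure (N n) X = measure (N n) {}" for n
      using X C_borel by (intro poset_law_measure_cong[OF N]) auto
    then have "measure M X = 0"
      using mM[OF X(1)] m_const[OF X(1)] by simp
    then have "X \<in> null_sets M"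
      using X C_borel sM by (intro null_setsI) (auto simp: emeasure_eq_measure)
    then show ?thesis by (rule AE_not_in)
  qed
  have "AE R in M. \<forall>x. \<not> R x x"
  proof (subst AE_all_countable, rule allI)
    fix x
    have "AE R in M. R \<notin> {R. R x x = True}"
      by (rule null) (auto simp: C_def PL_def clopen_rel clopen_rel[where b=True, simplified])
    then show "AE R in M. \<not> R x x" by simp
  qed
  moreover have "AE R in M. \<forall>x y z. \<not> (R x y \<and> R y z \<and> \<not> R x z)"
  proof (unfold AE_all_countable, intro allI)
    fix x y z
    have "AE R in M. R \<notin> {R. R x y = True} \<inter> {R. R y z = True} \<inter> {R. R x z = False}"
      by (rule null) (auto simp: C_def PL_def clopen_rel[where b=True, simplified] clopen_rel[where b=False, simplified] intro!: open_Int closed_Int)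
    then show "AE R in M. \<not> (R x y \<and> R y z \<and> \<not> R x z)" by simp
  qed
  ultimately have "AE R in M. R \<in> PL"
    by eventually_elim (auto simp: PL_def)
  then have "measure M PL = 1"
    using sM closed_PL by (subst prob_eq_1) auto
  with M sM have "random_poset_law M"
    by (simp add: random_poset_law_def emeasure_eq_measure)
  moreover have "(\<lambda>n. measure (N n) (ext_event A q)) \<longlonglongrightarrow> measure M (ext_event A q)"
    if "fin_poset (A, q)" for A q
  proof -
    have "ext_event A q \<in> C"
      unfolding ext_event_cyl using that by (intro cylC finite_ext fin_poset_finite)
    then show ?thesis using m mM by simp
  qed
  ultimately show thesis by (rule that)
qed

section \<open>Random labellings of a finite poset\<close>

text \<open>The images of the two injections have complements of equal size, so the partial matching
  extends to a permutation: permutations of \<open>B\<close> act transitively on injections into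
  it.\<close>

lemma finite_bij_extension:
  assumes "finite B" "\<phi> \<in> A \<rightarrow> B" "inj_on \<phi> A" "\<psi> \<in> A \<rightarrow> B" "inj_on \<psi> A"
  obtains \<tau> where "bij_betw \<tau> B B" "\<And>x. x \<in> A \<Longrightarrow> \<tau> (\<phi> x) = \<psi> x"
proof -
  have sub: "\<phi> ` A \<subseteq> B" "\<psi> ` A \<subseteq> B" using assms by auto
  have "card (B - \<phi> ` A) = card (B - \<psi> ` A)"
    using assms sub by (simp add: card_Diff_subset finite_subset card_image)
  then obtain b where b: "bij_betw b (B - \<phi> ` A) (B - \<psi> ` A)"
    using finite_same_card_bij assms(1) by (metis finite_Diff)
  define \<tau> where "\<tau> x = (if x \<in> \<phi> ` A then \<psi> (inv_into A \<phi> x) else b x)" for x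
  have eq: "\<tau> (\<phi> x) = \<psi> x" if "x \<in> A" for x
    using that assms(3) by (simp add: \<tau>_def)
  have "bij_betw \<tau> (\<phi> ` A) (\<psi> ` A)"
  proof (rule bij_betw_imageI)
    show "inj_on \<tau> (\<phi> ` A)" using eq assms(5) by (auto simp: inj_on_def)
    show "\<tau> ` \<phi> ` A = \<psi> ` A" using eq by (force simp: image_image)
  qed
  moreover have "bij_betw \<tau> (B - \<phi> ` A) (B - \<psi> ` A)"
    using b by (rule bij_betw_cong[THEN iffD1, rotated]) (auto simp: \<tau>_def)
  ultimately have "bij_betw \<tau> (\<phi> ` A \<union> (B - \<phi> ` A)) (\<psi> ` A \<union> (B - \<psi> ` A))"
    by (rule bij_betw_combine) auto
  with sub have "bij_betw \<tau> B B" by (simp add: Un_absorb1)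
  from that[OF this eq] show thesis .
qed

lemma finite_labellings: "finite (fst P) \<Longrightarrow> finite (labellings P)"
  unfolding labellings_def by (rule finite_subset[OF _ finite_PiE[of "{..<card (fst P)}" "\<lambda>_. fst P"]]) auto

lemma labellings_nonempty: assumes "finite (fst P)" shows "labellings P \<noteq> {}"
proof -
  obtain h where "bij_betw h {..<card (fst P)} (fst P)"
    using assms bij_betw_from_nat_into_finite by blast
  then have "restrict h {..<card (fst P)} \<in> labellings P"
    by (auto simp: labellings_def bij_betw_apply bij_betw_restrict_eq)
  then show ?thesis by blast
qed

text \<open>Composing with a permutation that carries one injection to the other maps the first
  fibre injectively into the second. Exchanging the two injections then shows that all fibres have
  the same size.\<close>

lemma labelling_fibre_card_le:
  fixes P :: fposet
  assumes fin: "finite (fst P)" and A: "A \<subseteq> {..<card (fst P)}"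
    and \<phi>: "\<phi> \<in> A \<rightarrow>\<^sub>E fst P" "inj_on \<phi> A" and \<psi>: "\<psi> \<in> A \<rightarrow>\<^sub>E fst P" "inj_on \<psi> A"
  shows "card {sg \<in> labellings P. restrict sg A = \<phi>} \<le> card {sg \<in> labellings P. restrict sg A = \<psi>}"
proof -
  let ?n = "{..<card (fst P)}"
  obtain \<tau> where \<tau>: "bij_betw \<tau> (fst P) (fst P)" "\<And>x. x \<in> A \<Longrightarrow> \<tau> (\<phi> x) = \<psi> x"
    using finite_bij_extension[OF fin, of \<phi> A \<psi>] \<phi> \<psi> by (auto simp: PiE_def)
  show ?thesis
  proof (rule card_inj_on_le[where f = "\<lambda>sg. restrict (\<tau> \<circ> sg) ?n"])
    show "finite {sg \<in> labellings P. restrict sg A = \<psi>}"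
      using finite_labellings[OF fin] by simp
    show "inj_on (\<lambda>sg. restrict (\<tau> \<circ> sg) ?n) {sg \<in> labellings P. restrict sg A = \<phi>}"
    proof (rule inj_onI)
      fix s t assume s: "s \<in> {sg \<in> labellings P. restrict sg A = \<phi>}"
        and t: "t \<in> {sg \<in> labellings P. restrict sg A = \<phi>}"
        and eq: "restrict (\<tau> \<circ> s) ?n = restrict (\<tau> \<circ> t) ?n"
      show "s = t"
      proof (rule PiE_ext[of s ?n "\<lambda>_. fst P"])
        fix i assume i: "i \<in> ?n"
        have "\<tau> (s i) = \<tau> (t i)" using fun_cong[OF eq, of i] i by simp
        moreover have "s i \<in> fst P" "t i \<in> fst P" using s t i by (auto simp: labellings_def)
        ultimately show "s i = t i" using \<tau>(1) by (auto simp: bij_betw_def inj_on_def)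
      qed (use s t in \<open>auto simp: labellings_def\<close>)
    qed
    show "(\<lambda>sg. restrict (\<tau> \<circ> sg) ?n) ` {sg \<in> labellings P. restrict sg A = \<phi>}
        \<subseteq> {sg \<in> labellings P. restrict sg A = \<psi>}"
    proof (rule image_subsetI)
      fix s assume s: "s \<in> {sg \<in> labellings P. restrict sg A = \<phi>}"
      have "bij_betw (\<tau> \<circ> s) ?n (fst P)"
        using s by (intro bij_betw_trans[OF _ \<tau>(1)]) (auto simp: labellings_def)
      then have "restrict (\<tau> \<circ> s) ?n \<in> labellings P"
        by (auto simp: labellings_def bij_betw_apply bij_betw_restrict_eq dest: bij_betwE)
      moreover have "restrict (restrict (\<tau> \<circ> s) ?n) A = \<psi>"
      proof
        fix x
        show "restrict (restrict (\<tau> \<circ> s) ?n) A x = \<psi> x"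
        proof (cases "x \<in> A")
          case True
          then have "s x = \<phi> x" using s by auto
          with True show ?thesis using A \<tau>(2)[of x] by auto
        next
          case False
          then show ?thesis using PiE_arb[OF \<psi>(1)] by simp
        qed
      qed
      ultimately show "restrict (\<tau> \<circ> s) ?n \<in> {sg \<in> labellings P. restrict sg A = \<psi>}" by simp
    qed
  qed
qed

text \<open>A uniformly random labelling restricts to a uniformly random injection.\<close>
lemma labelling_restrict_count:
  fixes P :: fposet
  assumes fin: "finite (fst P)" and A: "A \<subseteq> {..<card (fst P)}"
  shows "real (card {sg \<in> labellings P. T (restrict sg A)}) / real (card (labellings P)) =
    real (card {\<phi> \<in> A \<rightarrow>\<^sub>E fst P. inj_on \<phi> A \<and> T \<phi>}) / real (card {\<phi> \<in> A \<rightarrow>\<^sub>E fst P. inj_on \<phi> A})"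
proof -
  define I where "I = {\<phi> \<in> A \<rightarrow>\<^sub>E fst P. inj_on \<phi> A}"
  define fib where "fib \<phi> = {sg \<in> labellings P. restrict sg A = \<phi>}" for \<phi>
  have finA: "finite A" using A finite_subset by blast
  have finI: "finite I"
    unfolding I_def by (rule finite_subset[OF _ finite_PiE[OF finA, of "\<lambda>_. fst P"]]) (use fin in auto)
  have restr: "restrict sg A \<in> I" if "sg \<in> labellings P" for sg
    using that A by (auto simp: I_def labellings_def bij_betw_def inj_on_restrict_eq intro: inj_on_subset)
  obtain sg0 where sg0: "sg0 \<in> labellings P" using labellings_nonempty[OF fin] by blast
  \<comment> \<open>The common size of all fibres, read off at one arbitrary labelling; it cancels
    from the quotient.\<close>
  define c where "c = card (fib (restrict sg0 A))"
  have c: "card (fib \<phi>) = c" if "\<phi> \<in> I" for \<phi>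
    using labelling_fibre_card_le[OF fin A] that restr[OF sg0]
    by (intro antisym) (auto simp: c_def fib_def I_def)
  have count: "card {sg \<in> labellings P. S (restrict sg A)} = card {\<phi> \<in> I. S \<phi>} * c" for S
  proof -
    have "{sg \<in> labellings P. S (restrict sg A)} = (\<Union>\<phi>\<in>{\<phi> \<in> I. S \<phi>}. fib \<phi>)"
      using restr by (auto simp: fib_def)
    also have "card \<dots> = (\<Sum>\<phi>\<in>{\<phi> \<in> I. S \<phi>}. card (fib \<phi>))"
      using finI finite_labellings[OF fin] by (intro card_UN_disjoint) (auto simp: fib_def)
    also have "\<dots> = card {\<phi> \<in> I. S \<phi>} * c" using c by simp
    finally show ?thesis .
  qed
  have "c > 0"
    unfolding c_def using finite_labellings[OF fin] sg0 by (subst card_gt_0_iff) (auto simp: fib_def)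
  moreover have "{\<phi> \<in> A \<rightarrow>\<^sub>E fst P. inj_on \<phi> A \<and> T \<phi>} = {\<phi> \<in> I. T \<phi>}"
    by (auto simp: I_def)
  ultimately show ?thesis
    using count[of T] count[of "\<lambda>_. True"] by (simp add: I_def[symmetric])
qed

text \<open>An event that depends only on the relation on \<open>A\<close> sees a labelling only
  through its restriction to \<open>A\<close>, a uniform injection. The labels in \<open>A\<close>
  have to be genuine ones, because those from \<open>card (fst P)\<close> on are isolated
  padding.\<close>

lemma measure_hat_law:
  assumes P: "fin_poset P" and A: "A \<subseteq> {..<card (fst P)}"
    and local: "\<And>R R'. (\<And>x y. x \<in> A \<Longrightarrow> y \<in> A \<Longrightarrow> R x y = R' x y) \<Longrightarrow> T R = T R'"
  shows "measure (hat_law P) {R. T R} =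
    real (card {\<phi> \<in> A \<rightarrow>\<^sub>E fst P. inj_on \<phi> A \<and> T (\<lambda>x y. snd P (\<phi> x) (\<phi> y))}) /
    real (card {\<phi> \<in> A \<rightarrow>\<^sub>E fst P. inj_on \<phi> A})"
proof -
  have fin: "finite (fst P)" using P by (auto simp: fin_poset_def)
  have "measure (hat_law P) {R. T R} =
      measure (measure_pmf (pmf_of_set (labellings P))) {sg. T (relabel P sg)}"
    by (simp add: hat_law_def vimage_def)
  also have "\<dots> = real (card {sg \<in> labellings P. T (relabel P sg)}) / real (card (labellings P))"
    using finite_labellings[OF fin] labellings_nonempty[OF fin]
    by (simp add: measure_pmf_of_set Int_def)
  also have "{sg \<in> labellings P. T (relabel P sg)} =
      {sg \<in> labellings P. T (\<lambda>x y. snd P (restrict sg A x) (restrict sg A y))}"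
    using A by (intro Collect_cong conj_cong refl local) (auto simp: relabel_def)
  finally show ?thesis
    using labelling_restrict_count[OF fin A, of "\<lambda>\<phi>. T (\<lambda>x y. snd P (\<phi> x) (\<phi> y))"] by simp
qed

lemma poset_law_hat_law:
  assumes "fin_poset P" shows "poset_law (hat_law P)"
proof -
  have "relabel P sg \<in> PL" for sg
    using assms by (auto simp: relabel_def PL_def fin_poset_def)
  then have "measure (hat_law P) PL = 1"
    unfolding hat_law_def by (subst measure_pmf.prob_eq_1) (auto intro!: AE_pmfI)
  then show ?thesis
    by (simp add: poset_law_def hat_law_def measure_pmf.prob_space_axioms)
qed

text \<open>Exact, unlike the comparison for homomorphisms: \<open>ind_dens\<close> averages over
  injections, which is how a random labelling restricts. The zero branch of \<open>ind_dens\<close>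
  is excluded by the size of \<open>A\<close>.\<close>

lemma ind_dens_eq_hat_law:
  assumes P: "fin_poset P" and A: "A \<subseteq> {..<card (fst P)}"
  shows "ind_dens (A, q) P = measure (hat_law P) {R. \<forall>x\<in>A. \<forall>y\<in>A. R x y \<longleftrightarrow> q x y}"
proof -
  have "card A \<le> card (fst P)" using card_mono[OF _ A] by simp
  moreover have "measure (hat_law P) {R. \<forall>x\<in>A. \<forall>y\<in>A. q x y \<longleftrightarrow> R x y} =
    real (card {\<phi> \<in> A \<rightarrow>\<^sub>E fst P. inj_on \<phi> A \<and> (\<forall>x\<in>A. \<forall>y\<in>A. q x y \<longleftrightarrow> snd P (\<phi> x) (\<phi> y))}) /
    real (card {\<phi> \<in> A \<rightarrow>\<^sub>E fst P. inj_on \<phi> A})"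
    by (rule measure_hat_law[OF P A]) auto
  ultimately show ?thesis
    by (simp add: ind_dens_def case_prod_unfold eq_commute[of "q _ _"])
qed

text \<open>A union bound over ordered pairs of distinct points: a prescribed collision leaves one
  value undetermined fewer, a proportion of \<open>1 / card B\<close>. Multiplying out keeps the
  estimate in the naturals and covers an empty \<open>B\<close>.\<close>

lemma card_not_inj_le:
  assumes "finite A" "finite B"
  shows "card {\<phi> \<in> A \<rightarrow>\<^sub>E B. \<not> inj_on \<phi> A} * card B \<le> (card A)\<^sup>2 * card (A \<rightarrow>\<^sub>E B)"
proof -
  define D where "D p = {\<phi> \<in> A \<rightarrow>\<^sub>E B. \<phi> (fst p) = \<phi> (snd p)}" for p
  define O' where "O' = {p \<in> A \<times> A. fst p \<noteq> snd p}"
  have D: "card (D (x, y)) * card B \<le> card (A \<rightarrow>\<^sub>E B)" if "x \<in> A" "y \<in> A" "x \<noteq> y" for x y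
  proof -
    \<comment> \<open>The value at \<open>y\<close> equals the value at \<open>x\<close>, so nothing
      is lost by deleting \<open>y\<close> from the domain.\<close>
    have "card (D (x, y)) \<le> card ((A - {y}) \<rightarrow>\<^sub>E B)"
    proof (rule card_inj_on_le[where f = "\<lambda>\<phi>. restrict \<phi> (A - {y})"])
      show "inj_on (\<lambda>\<phi>. restrict \<phi> (A - {y})) (D (x, y))"
      proof (rule inj_onI)
        fix \<phi> \<psi> assume h: "\<phi> \<in> D (x, y)" "\<psi> \<in> D (x, y)"
          and eq: "restrict \<phi> (A - {y}) = restrict \<psi> (A - {y})"
        have e: "\<phi> z = \<psi> z" if "z \<in> A" "z \<noteq> y" for z
          using fun_cong[OF eq, of z] that by simp
        show "\<phi> = \<psi>"
        proof (rule PiE_ext[of _ A "\<lambda>_. B"])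
          fix z assume "z \<in> A"
          then show "\<phi> z = \<psi> z" using e[of z] e[of x] h that by (cases "z = y") (auto simp: D_def)
        qed (use h in \<open>auto simp: D_def\<close>)
      qed
      show "(\<lambda>\<phi>. restrict \<phi> (A - {y})) ` D (x, y) \<subseteq> (A - {y}) \<rightarrow>\<^sub>E B"
        by (intro image_subsetI) (auto simp: D_def restrict_PiE_iff)
    qed (use assms in \<open>intro finite_PiE; simp\<close>)
    then have "card (D (x, y)) * card B \<le> card B ^ card (A - {y}) * card B"
      using assms by (simp add: card_PiE)
    also have "\<dots> = card B ^ Suc (card (A - {y}))" by simp
    also have "\<dots> = card (A \<rightarrow>\<^sub>E B)"
      using assms that by (subst card_Suc_Diff1) (auto simp: card_PiE)
    finally show ?thesis .
  qed
  have fin: "finite (A \<rightarrow>\<^sub>E B)" "finite O'" using assms by (auto simp: O'_def intro!: finite_PiE)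
  have "{\<phi> \<in> A \<rightarrow>\<^sub>E B. \<not> inj_on \<phi> A} \<subseteq> (\<Union>p\<in>O'. D p)"
    by (fastforce simp: inj_on_def D_def O'_def)
  then have "card {\<phi> \<in> A \<rightarrow>\<^sub>E B. \<not> inj_on \<phi> A} \<le> card (\<Union>p\<in>O'. D p)"
    using fin by (intro card_mono) (auto simp: D_def)
  also have "\<dots> \<le> (\<Sum>p\<in>O'. card (D p))" using fin by (intro card_UN_le)
  finally have "card {\<phi> \<in> A \<rightarrow>\<^sub>E B. \<not> inj_on \<phi> A} * card B \<le> (\<Sum>p\<in>O'. card (D p) * card B)"
    by (simp flip: sum_distrib_right)
  also have "\<dots> \<le> (\<Sum>p\<in>O'. card (A \<rightarrow>\<^sub>E B))"
    using D by (intro sum_mono) (auto simp: O'_def)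
  also have "\<dots> \<le> card (A \<times> A) * card (A \<rightarrow>\<^sub>E B)"
    using card_mono[of "A \<times> A" O'] assms by (simp add: O'_def Collect_subset del: card_cartesian_product)
  finally show ?thesis by (simp add: card_cartesian_product power2_eq_square)
qed

text \<open>With the abbreviations of the proof the difference is
  \<open>(a/i - a/u) - (x - a)/u\<close>. Both terms lie between 0 and \<open>(u - i)/u\<close>, so
  their errors partly cancel and no factor 2 appears.\<close>

lemma proportion_subset_close:
  assumes U: "finite U" "I \<subseteq> U" "I \<noteq> {}" "X \<subseteq> U"
  shows "\<bar>real (card (X \<inter> I)) / real (card I) - real (card X) / real (card U)\<bar>
    \<le> real (card (U - I)) / real (card U)"
proof -
  define a i x u where "a = real (card (X \<inter> I))" "i = real (card I)" "x = real (card X)" "u = real (card U)"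
  note defs = this
  have finI: "finite I" using U finite_subset by blast
  have i: "0 < i" using U finI by (simp add: defs card_gt_0_iff)
  have iu: "i \<le> u" using U by (simp add: defs card_mono)
  have ai: "0 \<le> a" "a \<le> i" using finI by (simp_all add: defs card_mono)
  have d: "real (card (U - I)) = u - i" using U finI
    by (simp add: defs card_Diff_subset card_mono of_nat_diff)
  have "X \<subseteq> (X \<inter> I) \<union> (U - I)" using U by auto
  then have "card X \<le> card (X \<inter> I) + card (U - I)"
    using U by (meson card_Un_le card_mono finite_Diff finite_Int finite_Un finite_subset order_trans)
  then have xa: "x \<le> a + (u - i)" using d by (simp add: defs)
  have "finite X" using U finite_subset by blast
  then have ax: "a \<le> x" by (simp add: defs card_mono)
  have "a / i - x / u \<le> a / i - a / u" using ax i iu by (simp add: divide_right_mono)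
  also have "\<dots> = (a / i) * ((u - i) / u)" using i iu by (simp add: field_simps)
  also have "\<dots> \<le> 1 * ((u - i) / u)" using ai i iu by (intro mult_right_mono) auto
  finally have 1: "a / i - x / u \<le> (u - i) / u" by simp
  have "a / u \<le> a / i" using ai i iu by (simp add: frac_le)
  then have "x / u - a / i \<le> (x - a) / u" by (simp add: diff_divide_distrib)
  also have "\<dots> \<le> (u - i) / u" using xa i iu by (intro divide_right_mono) auto
  finally have 2: "x / u - a / i \<le> (u - i) / u" .
  show ?thesis using 1 2 unfolding d defs[symmetric] by linarith
qed

text \<open>The same set \<open>X\<close> of homomorphisms is measured among all maps for
  \<open>hom_dens\<close> and among injections for \<open>hat_law\<close>; the error is at most the
  proportion of non-injective maps.\<close>

lemma hat_law_hom_dens_close: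
  assumes P: "fin_poset P" and A: "A \<subseteq> {..<card (fst P)}"
  shows "\<bar>measure (hat_law P) (ext_event A q) - hom_dens (A, q) P\<bar> \<le> (real (card A))\<^sup>2 / real (card (fst P))"
proof -
  have fin: "finite (fst P)" "fst P \<noteq> {}" using P by (auto simp: fin_poset_def)
  have finA: "finite A" using A finite_subset by blast
  define U where "U = A \<rightarrow>\<^sub>E fst P"
  define I where "I = {\<phi> \<in> U. inj_on \<phi> A}"
  define X where "X = {\<phi> \<in> U. \<forall>x\<in>A. \<forall>y\<in>A. q x y \<longrightarrow> snd P (\<phi> x) (\<phi> y)}"
  have finU: "finite U" unfolding U_def using fin finA by (intro finite_PiE) auto
  have "U \<noteq> {}" using fin by (simp add: U_def PiE_eq_empty_iff)
  then have u: "card U > 0" "card (fst P) > 0" using fin finU by (simp_all add: card_gt_0_iff)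
  have "I \<noteq> {}"
  proof -
    obtain sg where sg: "sg \<in> labellings P" using labellings_nonempty[OF fin(1)] by blast
    then have "restrict sg A \<in> I"
      using A by (auto simp: I_def U_def labellings_def bij_betw_def inj_on_restrict_eq intro: inj_on_subset)
    then show ?thesis by blast
  qed
  have "measure (hat_law P) (ext_event A q) =
    real (card {\<phi> \<in> A \<rightarrow>\<^sub>E fst P. inj_on \<phi> A \<and> (\<forall>x\<in>A. \<forall>y\<in>A. q x y \<longrightarrow> snd P (\<phi> x) (\<phi> y))}) /
    real (card {\<phi> \<in> A \<rightarrow>\<^sub>E fst P. inj_on \<phi> A})"
    unfolding ext_event_def by (rule measure_hat_law[OF P A]) auto
  also have "{\<phi> \<in> A \<rightarrow>\<^sub>E fst P. inj_on \<phi> A \<and> (\<forall>x\<in>A. \<forall>y\<in>A. q x y \<longrightarrow> snd P (\<phi> x) (\<phi> y))} = X \<inter> I"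
    by (auto simp: X_def I_def U_def)
  finally have m: "measure (hat_law P) (ext_event A q) = real (card (X \<inter> I)) / real (card I)"
    by (simp add: I_def U_def)
  have h: "hom_dens (A, q) P = real (card X) / real (card U)"
    by (simp add: hom_dens_def X_def U_def case_prod_unfold)
  have "U - I = {\<phi> \<in> A \<rightarrow>\<^sub>E fst P. \<not> inj_on \<phi> A}" by (auto simp: I_def U_def)
  then have "card (U - I) * card (fst P) \<le> (card A)\<^sup>2 * card U"
    using card_not_inj_le[OF finA fin(1)] by (simp add: U_def)
  then have "real (card (U - I)) * real (card (fst P)) \<le> (real (card A))\<^sup>2 * real (card U)"
    by (metis of_nat_le_iff of_nat_mult of_nat_power)
  then have "real (card (U - I)) / real (card U) \<le> (real (card A))\<^sup>2 / real (card (fst P))"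
    using u by (simp add: field_simps)
  moreover have "\<bar>real (card (X \<inter> I)) / real (card I) - real (card X) / real (card U)\<bar>
    \<le> real (card (U - I)) / real (card U)"
    using finU \<open>I \<noteq> {}\<close> by (intro proportion_subset_close) (auto simp: I_def X_def)
  ultimately show ?thesis unfolding m h by linarith
qed

lemma hat_law_hom_dens_tendsto:
  assumes P: "\<forall>\<^sub>F i in F. fin_poset (P i)"
    and size: "filterlim (\<lambda>i. card (fst (P i))) at_top F" and A: "finite A"
  shows "((\<lambda>i. measure (hat_law (P i)) (ext_event A q)) \<longlongrightarrow> L) F \<longleftrightarrow>
    ((\<lambda>i. hom_dens (A, q) (P i)) \<longlongrightarrow> L) F"
proof (rule Lim_transform_eq)
  obtain k where k: "A \<subseteq> {..<k}" using A finite_nat_iff_bounded by blast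
  have "\<forall>\<^sub>F i in F. k \<le> card (fst (P i))"
    using size by (auto simp: filterlim_at_top)
  with P have "\<forall>\<^sub>F i in F. norm (measure (hat_law (P i)) (ext_event A q) - hom_dens (A, q) (P i))
      \<le> (real (card A))\<^sup>2 * inverse (real (card (fst (P i))))"
  proof eventually_elim
    case (elim i)
    then show ?case using k hat_law_hom_dens_close[OF elim(1), of A q]
      by (auto simp: field_simps lessThan_subset_iff order_trans)
  qed
  moreover have "((\<lambda>i. (real (card A))\<^sup>2 * inverse (real (card (fst (P i))))) \<longlongrightarrow> 0) F"
    by (intro tendsto_mult_right_zero tendsto_inverse_0_at_top
        filterlim_compose[OF filterlim_real_sequentially size])
  ultimately show "((\<lambda>i. measure (hat_law (P i)) (ext_event A q) - hom_dens (A, q) (P i)) \<longlongrightarrow> 0) F"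
    by (rule Lim_null_comparison)
qed

section \<open>The random poset of a kernel\<close>

abbreviation unif01 :: "real measure" where
  "unif01 \<equiv> uniform_measure lborel {0..1}"

lemma prob_space_unif01: "prob_space unif01"
  by (rule prob_space_uniform_measure) auto

text \<open>The endpoint 1 is discarded because transitivity of the random poset needs
  \<open>xi < W\<close> whenever \<open>W = 1\<close>.\<close>

lemma AE_unif01: "AE x in unif01. 0 \<le> x \<and> x < 1"
proof -
  have "AE x in lborel. x \<noteq> (1::real)"
    by (rule AE_lborel_singleton)
  then show ?thesis
    by (subst AE_uniform_measure) (auto elim!: eventually_mono)
qed

lemma emeasure_unif01_lessThan:
  assumes "0 \<le> w" "w \<le> 1" shows "emeasure unif01 {..<w} = ennreal w"
proof -
  have "{0..1} \<inter> {..<w} = {0..<w}" using assms by auto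
  then show ?thesis using assms by (simp add: divide_ennreal_def)
qed

lemma kernelD:
  assumes "is_kernel mu prec W"
  shows "prob_space mu" "(\<lambda>(x, y). W x y) \<in> borel_measurable (mu \<Otimes>\<^sub>M mu)"
    "\<And>x y. x \<in> space mu \<Longrightarrow> y \<in> space mu \<Longrightarrow> 0 \<le> W x y \<and> W x y \<le> 1"
    "\<And>x. x \<in> space mu \<Longrightarrow> W x x \<le> 0"
    "\<And>x y z. \<lbrakk>x \<in> space mu; y \<in> space mu; z \<in> space mu; W x y > 0; W y z > 0\<rbrakk> \<Longrightarrow> W x z = 1"
proof -
  note h = assms[unfolded is_kernel_def ordered_prob_space_def]
  from h show "prob_space mu" "(\<lambda>(x, y). W x y) \<in> borel_measurable (mu \<Otimes>\<^sub>M mu)"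
    "\<And>x y. x \<in> space mu \<Longrightarrow> y \<in> space mu \<Longrightarrow> 0 \<le> W x y \<and> W x y \<le> 1"
    by blast+
  from h show "\<And>x y z. \<lbrakk>x \<in> space mu; y \<in> space mu; z \<in> space mu; W x y > 0; W y z > 0\<rbrakk> \<Longrightarrow> W x z = 1"
    by blast
  from h have "\<And>x. x \<in> space mu \<Longrightarrow> \<not> W x x > 0" by blast
  then show "\<And>x. x \<in> space mu \<Longrightarrow> W x x \<le> 0" by (simp only: not_less)
qed

lemma kernel_component_measurable:
  assumes W: "is_kernel mu prec W" and "i \<in> I" "j \<in> I"
  shows "(\<lambda>x. W (x i) (x j)) \<in> borel_measurable (PiM I (\<lambda>_. mu))"
proof -
  have "(\<lambda>x. (x i, x j)) \<in> PiM I (\<lambda>_. mu) \<rightarrow>\<^sub>M mu \<Otimes>\<^sub>M mu"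
    using assms by (intro measurable_Pair measurable_component_singleton)
  from measurable_comp[OF this kernelD(2)[OF W]] show ?thesis by (simp add: comp_def)
qed

lemma P_inf_law_map_measurable:
  assumes W: "is_kernel mu prec W"
  shows "(\<lambda>(X, xi) i j. xi (i, j) < W (X i) (X j)) \<in>
    PiM UNIV (\<lambda>_::nat. mu) \<Otimes>\<^sub>M PiM UNIV (\<lambda>_::nat \<times> nat. unif01) \<rightarrow>\<^sub>M borel"
    (is "_ \<in> ?M \<Otimes>\<^sub>M ?U \<rightarrow>\<^sub>M _")
proof (rule measurable_relI)
  fix i j :: nat
  have W_meas: "(\<lambda>p. W (fst p i) (fst p j)) \<in> borel_measurable (?M \<Otimes>\<^sub>M ?U)"
    using measurable_comp[OF measurable_fst kernel_component_measurable[OF W, of i UNIV j]]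
    by (simp add: comp_def)
  have "(\<lambda>xi. xi (i, j)) \<in> ?U \<rightarrow>\<^sub>M unif01"
    by (rule measurable_component_singleton) simp
  then have "(\<lambda>xi. xi (i, j)) \<in> borel_measurable ?U" by simp
  from measurable_comp[OF measurable_snd this]
  have xi_meas: "(\<lambda>p. snd p (i, j)) \<in> borel_measurable (?M \<Otimes>\<^sub>M ?U)" by (simp add: comp_def)
  show "{p \<in> space (?M \<Otimes>\<^sub>M ?U). (case p of (X, xi) \<Rightarrow> \<lambda>i j. xi (i, j) < W (X i) (X j)) i j}
      \<in> sets (?M \<Otimes>\<^sub>M ?U)"
    unfolding case_prod_unfold by (rule borel_measurable_less[OF xi_meas W_meas])
qed

text \<open>If \<open>xi\<close> takes values in [0,1), a realised relation forces
  \<open>W > 0\<close>. Two consecutive relations then give \<open>W = 1\<close> for the outer pair,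
  which is therefore realised. Only a null set of \<open>xi\<close> is lost, for each fixed sample
  \<open>X\<close>.\<close>

lemma poset_law_P_inf_law:
  assumes W: "is_kernel mu prec W"
  shows "poset_law (P_inf_law mu W)"
proof -
  let ?M = "PiM UNIV (\<lambda>_::nat. mu)" and ?U = "PiM UNIV (\<lambda>_::nat \<times> nat. unif01)"
  let ?G = "\<lambda>(X, xi) i j. xi (i, j) < W (X i) (X j)"
  note G = P_inf_law_map_measurable[OF W]
  interpret M: prob_space ?M by (intro prob_space_PiM kernelD(1)[OF W])
  interpret U: prob_space ?U by (intro prob_space_PiM prob_space_unif01)
  interpret MU: pair_prob_space ?M ?U ..
  interpret D: prob_space "P_inf_law mu W"
    unfolding P_inf_law_def by (rule MU.prob_space_distr[OF G])
  have xi: "AE xi in ?U. \<forall>ij. 0 \<le> xi ij \<and> xi ij < 1"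
    unfolding AE_all_countable
    by (intro allI AE_PiM_component prob_space_unif01 AE_unif01) simp
  have "AE p in ?M \<Otimes>\<^sub>M ?U. ?G p \<in> PL"
  proof (rule MU.AE_pair_measure)
    show "{p \<in> space (?M \<Otimes>\<^sub>M ?U). ?G p \<in> PL} \<in> sets (?M \<Otimes>\<^sub>M ?U)"
      using measurable_sets[OF G borel_closed[OF closed_PL]] by (simp add: vimage_def Int_def conj_commute)
    show "AE X in ?M. AE xi in ?U. ?G (X, xi) \<in> PL"
    proof (rule AE_I2)
      fix X assume "X \<in> space ?M"
      then have X: "X i \<in> space mu" for i by (auto simp: space_PiM)
      from xi show "AE xi in ?U. ?G (X, xi) \<in> PL"
      proof eventually_elim
        case (elim xi)
        then have bd: "0 \<le> xi ij" "xi ij < 1" for ij by blast+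
        have "\<not> xi (i, i) < W (X i) (X i)" for i
          using kernelD(4)[OF W X] bd(1)[of "(i, i)"] by (meson not_less order_trans)
        moreover have "xi (i, k) < W (X i) (X k)"
          if "xi (i, j) < W (X i) (X j)" "xi (j, k) < W (X j) (X k)" for i j k
          using kernelD(5)[OF W X X X, of i j k] that bd(1)[of "(i, j)"] bd(1)[of "(j, k)"] bd(2)[of "(i, k)"]
          by simp
        ultimately show ?case by (auto simp: PL_def)
      qed
    qed
  qed
  then have "AE R in P_inf_law mu W. R \<in> PL"
    unfolding P_inf_law_def using closed_PL by (subst AE_distr_iff[OF G]) auto
  then have "measure (P_inf_law mu W) PL = 1"
    using closed_PL by (subst D.prob_eq_1) (auto simp: P_inf_law_def)
  then show ?thesis
    using D.prob_space_axioms by (simp add: poset_law_def P_inf_law_def)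
qed

text \<open>Conditionally on the sample \<open>X\<close>, the required relations are independent
  with probabilities \<open>W (X i) (X j)\<close>; integrating their product over \<open>X\<close>
  gives the density of \<open>Pi_W\<close>.\<close>

lemma measure_P_inf_law_ext_event:
  assumes W: "is_kernel mu prec W" and Q: "fin_poset (A, q)"
  shows "measure (P_inf_law mu W) (ext_event A q) = fst (Pi_W mu W) (A, q)"
proof -
  let ?M = "PiM UNIV (\<lambda>_::nat. mu)" and ?U = "PiM UNIV (\<lambda>_::nat \<times> nat. unif01)"
  let ?MA = "PiM A (\<lambda>_. mu)"
  let ?G = "\<lambda>(X, xi) i j. xi (i, j) < W (X i) (X j)"
  note G = P_inf_law_map_measurable[OF W]
  define E where "E = {(i, j). i \<in> A \<and> j \<in> A \<and> q i j}"
  define g where "g x = (\<Prod>(i, j)\<in>E. W (x i) (x j))" for x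
  have finA: "finite A" using Q by (rule fin_poset_finite)
  have finE: "finite E" unfolding E_def by (rule finite_ext[OF finA])
  interpret mu: prob_space mu by (rule kernelD(1)[OF W])
  interpret PP: product_prob_space "\<lambda>_::nat. mu" UNIV ..
  interpret un: prob_space unif01 by (rule prob_space_unif01)
  interpret UU: product_prob_space "\<lambda>_::nat \<times> nat. unif01" UNIV ..
  interpret MA: prob_space ?MA by (intro prob_space_PiM kernelD(1)[OF W])
  interpret D: prob_space "P_inf_law mu W" using poset_lawD[OF poset_law_P_inf_law[OF W]] by simp
  have g_meas: "g \<in> borel_measurable ?MA"
    unfolding g_def case_prod_unfold
    by (intro borel_measurable_prod kernel_component_measurable[OF W]) (auto simp: E_def)
  have g_bounds: "0 \<le> g x \<and> g x \<le> 1" if "\<And>i. i \<in> A \<Longrightarrow> x i \<in> space mu" for x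
    using kernelD(3)[OF W] that unfolding g_def
    by (intro conjI prod_nonneg prod_le_1) (auto simp: E_def)
  have g_restrict: "g (restrict X A) = g X" for X
    unfolding g_def by (intro prod.cong) (auto simp: E_def)
  have slice: "emeasure ?U (Pair X -` (?G -` ext_event A q \<inter> space (?M \<Otimes>\<^sub>M ?U))) = ennreal (g X)"
    if "X \<in> space ?M" for X
  proof -
    have X: "X i \<in> space mu" for i using that by (auto simp: space_PiM)
    \<comment> \<open>For fixed \<open>X\<close> the event is a finite-dimensional box in the
      variables \<open>xi\<close>.\<close>
    have "Pair X -` (?G -` ext_event A q \<inter> space (?M \<Otimes>\<^sub>M ?U)) =
        prod_emb UNIV (\<lambda>_. unif01) E (Pi\<^sub>E E (\<lambda>(i, j). {..<W (X i) (X j)}))"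
      using that by (auto simp: prod_emb_def ext_event_def E_def space_pair_measure space_PiM PiE_iff)
    also have "emeasure ?U \<dots> = (\<Prod>(i, j)\<in>E. emeasure unif01 {..<W (X i) (X j)})"
      using finE by (subst UU.emeasure_PiM_emb) (auto simp: case_prod_unfold)
    also have "\<dots> = (\<Prod>(i, j)\<in>E. ennreal (W (X i) (X j)))"
      using kernelD(3)[OF W X X] by (intro prod.cong) (auto simp: emeasure_unif01_lessThan simp del: emeasure_uniform_measure)
    also have "\<dots> = ennreal (g X)"
      using kernelD(3)[OF W X X] unfolding g_def case_prod_unfold by (intro prod_ennreal) auto
    finally show ?thesis .
  qed
  have meas: "?G -` ext_event A q \<inter> space (?M \<Otimes>\<^sub>M ?U) \<in> sets (?M \<Otimes>\<^sub>M ?U)"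
    using G borel_ext_event[OF finA] by (rule measurable_sets)
  have "emeasure (P_inf_law mu W) (ext_event A q) =
      emeasure (?M \<Otimes>\<^sub>M ?U) (?G -` ext_event A q \<inter> space (?M \<Otimes>\<^sub>M ?U))"
    unfolding P_inf_law_def using G borel_ext_event[OF finA] by (rule emeasure_distr)
  also have "\<dots> = (\<integral>\<^sup>+X. emeasure ?U (Pair X -` (?G -` ext_event A q \<inter> space (?M \<Otimes>\<^sub>M ?U))) \<partial>?M)"
    by (rule UU.P.emeasure_pair_measure_alt[OF meas])
  also have "\<dots> = (\<integral>\<^sup>+X. ennreal (g (restrict X A)) \<partial>?M)"
    by (intro nn_integral_cong) (simp only: slice g_restrict)
  also have "\<dots> = (\<integral>\<^sup>+x. ennreal (g x) \<partial>(distr ?M ?MA (\<lambda>X. restrict X A)))"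
    using g_meas by (intro nn_integral_distr[symmetric] measurable_restrict_subset) auto
  \<comment> \<open>The integrand involves only the coordinates in \<open>A\<close>, so the infinite
    product may be replaced by its marginal.\<close>
  also have "distr ?M ?MA (\<lambda>X. restrict X A) = ?MA"
    using finA by (rule PP.distr_PiM_restrict_finite) simp
  also have "(\<integral>\<^sup>+x. ennreal (g x) \<partial>?MA) = ennreal (\<integral>x. g x \<partial>?MA)"
  proof (rule nn_integral_eq_integral)
    have b: "0 \<le> g x \<and> g x \<le> 1" if "x \<in> space ?MA" for x
      using that by (intro g_bounds) (auto simp: space_PiM)
    show "integrable ?MA g"
      using b g_meas by (intro MA.integrable_const_bound[of _ 1]) auto
    show "AE x in ?MA. 0 \<le> g x" using b by auto
  qed
  finally have "emeasure (P_inf_law mu W) (ext_event A q) = ennreal (\<integral>x. g x \<partial>?MA)" .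
  moreover have "0 \<le> (\<integral>x. g x \<partial>?MA)"
    by (intro Bochner_Integration.integral_nonneg conjunct1[OF g_bounds]) (auto simp: space_PiM)
  ultimately have "measure (P_inf_law mu W) (ext_event A q) = (\<integral>x. g x \<partial>?MA)"
    by (simp add: measure_def)
  then show ?thesis
    using Q by (simp add: Pi_W_def g_def E_def)
qed

section \<open>Convergence\<close>

text \<open>Composition with \<open>pm\<close> matches both the homomorphisms and all maps. This
  isomorphism invariance in Q is the source of exchangeability.\<close>

lemma hom_dens_relabel:
  fixes pm :: "nat \<Rightarrow> nat"
  assumes pm: "bij pm"
  shows "hom_dens (pm ` A, \<lambda>u v. q (inv pm u) (inv pm v)) P = hom_dens (A, q) P"
proof -
  have inv: "inv pm (pm x) = x" "pm (inv pm x) = x" for x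
    using pm by (simp_all add: bij_is_inj bij_is_surj surj_f_inv_f)
  have ext: "restrict (restrict (\<phi> \<circ> inv pm) (pm ` A) \<circ> pm) A = \<phi>" if "\<phi> \<in> A \<rightarrow>\<^sub>E fst P" for \<phi>
  proof
    fix x show "restrict (restrict (\<phi> \<circ> inv pm) (pm ` A) \<circ> pm) A x = \<phi> x"
      using PiE_arb[OF that, of x] by (cases "x \<in> A") (simp_all add: inv)
  qed
  have ext': "restrict (restrict (\<phi> \<circ> pm) A \<circ> inv pm) (pm ` A) = \<phi>" if "\<phi> \<in> pm ` A \<rightarrow>\<^sub>E fst P" for \<phi>
  proof
    fix x
    have "inv pm x \<in> A" if "x \<in> pm ` A" using that inv by force
    then show "restrict (restrict (\<phi> \<circ> pm) A \<circ> inv pm) (pm ` A) x = \<phi> x"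
      using PiE_arb[OF that, of x] by (cases "x \<in> pm ` A") (simp_all add: inv)
  qed
  have "bij_betw (\<lambda>\<phi>. restrict (\<phi> \<circ> pm) A)
      {\<phi> \<in> pm ` A \<rightarrow>\<^sub>E fst P. \<forall>x\<in>pm ` A. \<forall>y\<in>pm ` A. q (inv pm x) (inv pm y) \<longrightarrow> snd P (\<phi> x) (\<phi> y)}
      {\<phi> \<in> A \<rightarrow>\<^sub>E fst P. \<forall>x\<in>A. \<forall>y\<in>A. q x y \<longrightarrow> snd P (\<phi> x) (\<phi> y)}"
    by (rule bij_betw_byWitness[where f' = "\<lambda>\<phi>. restrict (\<phi> \<circ> inv pm) (pm ` A)"])
      (auto simp: ext ext' inv restrict_PiE_iff)
  moreover have "bij_betw (\<lambda>\<phi>. restrict (\<phi> \<circ> pm) A) (pm ` A \<rightarrow>\<^sub>E fst P) (A \<rightarrow>\<^sub>E fst P)"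
    by (rule bij_betw_byWitness[where f' = "\<lambda>\<phi>. restrict (\<phi> \<circ> inv pm) (pm ` A)"])
      (auto simp: ext ext' inv restrict_PiE_iff)
  ultimately show ?thesis
    by (simp add: hom_dens_def case_prod_unfold bij_betw_same_card)
qed

lemma poset_law_distr_relabel:
  fixes pm :: "nat \<Rightarrow> nat"
  assumes M: "random_poset_law M"
  shows "poset_law (distr M borel (\<lambda>R i j. R (pm i) (pm j)))" (is "poset_law ?D")
    and "A \<in> sets borel \<Longrightarrow> measure (distr M borel (\<lambda>R i j. R (pm i) (pm j))) A = measure M {R. (\<lambda>i j. R (pm i) (pm j)) \<in> A}"
proof -
  have M': "poset_law M" "sets M = sets borel" "space M = UNIV"
    using M poset_lawD(2) by (auto simp: random_poset_law_iff)
  have meas: "(\<lambda>R i j. R (pm i) (pm j)) \<in> M \<rightarrow>\<^sub>M borel"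
  proof (rule measurable_relI)
    fix i j
    have "cyl {(pm i, pm j)} \<in> sets M" by (simp add: M' borel_cyl)
    then show "{R \<in> space M. R (pm i) (pm j)} \<in> sets M" by (simp add: M' cyl_def)
  qed
  show dist: "measure ?D A = measure M {R. (\<lambda>i j. R (pm i) (pm j)) \<in> A}" if "A \<in> sets borel" for A
    using that meas by (simp add: measure_distr M' vimage_def)
  interpret prob_space M using poset_lawD[OF M'(1)] by simp
  have "AE R in M. (\<lambda>i j. R (pm i) (pm j)) \<in> PL"
    using poset_lawD(5)[OF M'(1)] by eventually_elim (auto simp: PL_def)
  moreover have "{R. (\<lambda>i j. R (pm i) (pm j)) \<in> PL} \<in> sets M"
    using measurable_sets[OF meas borel_closed[OF closed_PL]] by (simp add: M' vimage_def)
  ultimately have "measure M {R. (\<lambda>i j. R (pm i) (pm j)) \<in> PL} = 1"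
    by (subst prob_eq_1) auto
  then have "measure ?D PL = 1" using dist[OF borel_closed[OF closed_PL]] by simp
  then show "poset_law ?D"
    using prob_space_distr[OF meas] by (simp add: poset_law_def)
qed

section \<open>Limits of embedded posets\<close>

lemma tendsto_fun_coordinate:
  fixes f :: "'i \<Rightarrow> 'a \<Rightarrow> 'b::topological_space"
  assumes "(f \<longlongrightarrow> l) F" shows "((\<lambda>i. f i x) \<longlongrightarrow> l x) F"
  using continuous_on_tendsto_compose[OF continuous_on_product_coordinates assms] by simp

lemma tendsto_fun_iff:
  fixes f :: "'i \<Rightarrow> 'a \<Rightarrow> 'b::topological_space"
  shows "(f \<longlongrightarrow> l) F \<longleftrightarrow> (\<forall>x. ((\<lambda>i. f i x) \<longlongrightarrow> l x) F)"
  using limitin_componentwise[of "\<lambda>_::'a. euclidean :: 'b topology" UNIV f l F]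
  by (simp add: euclidean_product_topology limitin_canonical_iff)

lemma emb_tendsto_hat_law:
  assumes P: "\<forall>\<^sub>F i in F. fin_poset (P i)" and size: "filterlim (\<lambda>i. card (fst (P i))) at_top F"
    and Lm: "((\<lambda>i. emb (P i)) \<longlongrightarrow> Lm) F" and Q: "fin_poset (A, q)"
  shows "((\<lambda>i. measure (hat_law (P i)) (ext_event A q)) \<longlongrightarrow> fst Lm (A, q)) F"
  using tendsto_fun_coordinate[OF tendsto_fst[OF Lm], of "(A, q)"] Q
  by (simp add: hat_law_hom_dens_tendsto[OF P size fin_poset_finite[OF Q]] emb_def)

text \<open>The coordinate \<open>1/|P|\<close> records the size, so growth can be recovered for
  posets that merely approach \<open>Lm\<close> in the embedding.\<close>

lemma emb_tendsto_snd_0: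
  assumes P: "\<forall>\<^sub>F i in F. fin_poset (P i)" and Lm: "((\<lambda>i. emb (P i)) \<longlongrightarrow> Lm) F" "snd Lm = 0"
  shows "filterlim (\<lambda>i. card (fst (P i))) at_top F"
  unfolding filterlim_at_top
proof
  fix Z :: nat
  have "((\<lambda>i. 1 / real (card (fst (P i)))) \<longlongrightarrow> 0) F"
    using tendsto_snd[OF Lm(1)] Lm(2) by (simp add: emb_def)
  from order_tendstoD(2)[OF this, of "1 / real (Suc Z)"]
  have "\<forall>\<^sub>F i in F. 1 / real (card (fst (P i))) < 1 / real (Suc Z)" by simp
  with P show "\<forall>\<^sub>F i in F. Z \<le> card (fst (P i))"
  proof eventually_elim
    case (elim i)
    then have "card (fst (P i)) > 0" by (auto simp: fin_poset_def card_gt_0_iff)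
    with elim(2) have "real (Suc Z) < real (card (fst (P i)))"
      by (simp add: field_simps del: of_nat_Suc)
    then show ?case by simp
  qed
qed

lemma snd_emb_pos: "fin_poset P \<Longrightarrow> snd (emb P) > 0"
  by (auto simp: emb_def fin_poset_def card_gt_0_iff)

lemma ind_event_clopen:
  assumes "finite A"
  shows "open {R :: nat \<Rightarrow> nat \<Rightarrow> bool. \<forall>x\<in>A. \<forall>y\<in>A. R x y \<longleftrightarrow> q x y}"
    and "closed {R :: nat \<Rightarrow> nat \<Rightarrow> bool. \<forall>x\<in>A. \<forall>y\<in>A. R x y \<longleftrightarrow> q x y}"
proof -
  have "{R. \<forall>x\<in>A. \<forall>y\<in>A. R x y \<longleftrightarrow> q x y} = (\<Inter>x\<in>A. \<Inter>y\<in>A. {R. R x y = q x y})" by auto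
  then show "open {R :: nat \<Rightarrow> nat \<Rightarrow> bool. \<forall>x\<in>A. \<forall>y\<in>A. R x y \<longleftrightarrow> q x y}"
    and "closed {R :: nat \<Rightarrow> nat \<Rightarrow> bool. \<forall>x\<in>A. \<forall>y\<in>A. R x y \<longleftrightarrow> q x y}"
    using assms by (simp_all only:) (intro open_INT closed_INT ballI clopen_rel assms)+
qed

text \<open>Since \<open>snd Lm = 0\<close>, the point \<open>Lm\<close> is not an embedded finite
  poset and \<open>ind_dens_bar\<close> takes its limit branch. Near \<open>Lm\<close> the posets
  are large, so their induced densities are probabilities under \<open>hat_law\<close> of one fixed
  clopen event, which converge.\<close>

lemma ind_dens_bar_eq_measure:
  assumes Lm: "Lm \<in> Pbar" "snd Lm = 0" and M: "poset_law M" and A: "finite A"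
    and meas: "\<And>A q. fin_poset (A, q) \<Longrightarrow> measure M (ext_event A q) = fst Lm (A, q)"
  shows "ind_dens_bar (A, q) Lm = measure M {R. \<forall>x\<in>A. \<forall>y\<in>A. R x y \<longleftrightarrow> q x y}" (is "_ = measure M ?I")
proof -
  let ?S = "emb ` {P. fin_poset P}"
  let ?F = "at Lm within ?S"
  define P where "P x = (SOME P. fin_poset P \<and> emb P = x)" for x
  have P_S: "fin_poset (P x) \<and> emb (P x) = x" if "x \<in> ?S" for x
  proof -
    from that have "\<exists>P. fin_poset P \<and> emb P = x" by blast
    then show ?thesis unfolding P_def by (rule someI_ex)
  qed
  have S: "\<forall>\<^sub>F x in ?F. x \<in> ?S" by (simp add: eventually_at_filter)
  have P: "\<forall>\<^sub>F x in ?F. fin_poset (P x)" using S by eventually_elim (simp only: P_S)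
  \<comment> \<open>Every embedded point is the image of its chosen representative, so the identity
    limit at \<open>Lm\<close> becomes convergence of \<open>emb (P x)\<close>.\<close>
  have emb_P: "\<forall>\<^sub>F x in ?F. x = emb (P x)" using S by eventually_elim (simp only: P_S)
  have lim: "((\<lambda>x. emb (P x)) \<longlongrightarrow> Lm) ?F"
    using tendsto_ident_at emb_P by (rule Lim_transform_eventually)
  note size = emb_tendsto_snd_0[OF P lim Lm(2)]
  have "((\<lambda>x. measure (hat_law (P x)) ?I) \<longlongrightarrow> measure M ?I) ?F"
  proof (rule clopen_measure_tendsto[OF _ M _ ind_event_clopen[OF A]])
    show "\<forall>\<^sub>F x in ?F. poset_law (hat_law (P x))"
      using P by eventually_elim (rule poset_law_hat_law)
    show "((\<lambda>x. measure (hat_law (P x)) (ext_event A q)) \<longlongrightarrow> measure M (ext_event A q)) ?F"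
      if "fin_poset (A, q)" for A q
      unfolding meas[OF that] by (rule emb_tendsto_hat_law[OF P size lim that])
  qed
  moreover have "\<forall>\<^sub>F x in ?F. measure (hat_law (P x)) ?I = ind_dens (A, q) (P x)"
  proof -
    obtain k where k: "A \<subseteq> {..<k}" using A finite_nat_iff_bounded by blast
    have "\<forall>\<^sub>F x in ?F. k \<le> card (fst (P x))" using size by (auto simp: filterlim_at_top)
    with P show ?thesis
    proof eventually_elim
      case (elim x)
      have "A \<subseteq> {..<card (fst (P x))}" using k elim(2) by auto
      then show ?case by (rule ind_dens_eq_hat_law[OF elim(1), symmetric])
    qed
  qed
  ultimately have "((\<lambda>x. ind_dens (A, q) (P x)) \<longlongrightarrow> measure M ?I) ?F"
    by (rule Lim_transform_eventually)
  moreover have notin: "Lm \<notin> ?S"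
    using Lm(2) snd_emb_pos by force
  \<comment> \<open>As a point of the closure outside the set, \<open>Lm\<close> is an accumulation
    point; this makes the value of \<open>Lim\<close> unique.\<close>
  moreover have "\<not> trivial_limit ?F"
    using Lm(1) notin by (auto simp: trivial_limit_within Pbar_def closure_def)
  ultimately show ?thesis
    unfolding ind_dens_bar_def P_def[symmetric] by (simp add: tendsto_Lim)
qed

text \<open>A finite \<open>hat_law\<close> is in general not invariant under permutations of all
  labels, because of its isolated padding. Invariance appears in the limit: extension probabilities
  are limits of homomorphism densities, and these ignore the names of the points of Q.\<close>

lemma exchangeable_limit:
  assumes P: "\<And>n. fin_poset (P n)" and size: "filterlim (\<lambda>n. card (fst (P n))) at_top sequentially"
    and M: "random_poset_law M"
    and lim: "\<And>A q. fin_poset (A, q) \<Longrightarrow>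
      (\<lambda>n. measure (hat_law (P n)) (ext_event A q)) \<longlonglongrightarrow> measure M (ext_event A q)"
  shows "exchangeable M"
  unfolding exchangeable_def
proof (intro allI impI)
  fix pm :: "nat \<Rightarrow> nat" assume pm: "bij pm"
  let ?D = "distr M borel (\<lambda>R i j. R (pm i) (pm j))"
  show "?D = M"
  proof (rule poset_law_eqI)
    show "poset_law ?D" using M by (rule poset_law_distr_relabel)
    show "poset_law M" "sets M = sets borel" using M by (auto simp: random_poset_law_iff)
    fix A q assume Q: "fin_poset (A, q)"
    let ?q = "\<lambda>u v. q (inv pm u) (inv pm v)"
    have inv: "inv pm (pm x) = x" for x
      using pm by (simp add: bij_is_inj)
    have surj: "\<exists>y. x = pm y" for x using bij_is_surj[OF pm] by (auto simp: surj_def)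
    have Q': "fin_poset (pm ` A, ?q)"
      unfolding fin_poset_def prod.case
    proof (intro conjI allI impI)
      show "x \<in> pm ` A" "y \<in> pm ` A" if "?q x y" for x y
        using that Q surj[of x] surj[of y] by (auto simp: fin_poset_def inv)
    qed (use Q in \<open>auto simp: fin_poset_def\<close>)
    have hom: "(\<lambda>n. hom_dens (A, q) (P n)) \<longlonglongrightarrow> measure M (ext_event A q)" if "fin_poset (A, q)" for A q
      using lim[OF that] hat_law_hom_dens_tendsto[OF always_eventually[OF allI[OF P]] size fin_poset_finite[OF that]]
      by simp
    have "measure ?D (ext_event A q) = measure M {R. (\<lambda>i j. R (pm i) (pm j)) \<in> ext_event A q}"
      using M borel_ext_event[OF fin_poset_finite[OF Q]] by (rule poset_law_distr_relabel)
    also have "{R. (\<lambda>i j. R (pm i) (pm j)) \<in> ext_event A q} = ext_event (pm ` A) ?q"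
      by (auto simp: ext_event_def inv)
    also have "measure M \<dots> = measure M (ext_event A q)"
      using hom[OF Q'] hom[OF Q] unfolding hom_dens_relabel[OF pm] by (rule LIMSEQ_unique)
    finally show "measure ?D (ext_event A q) = measure M (ext_event A q)" .
  qed simp
qed

text \<open>Extension events are clopen, so their indicators are admissible test functions; the
  converse is the density argument.\<close>

lemma conv_distr_PL_iff:
  assumes N: "\<And>n. poset_law (N n)" and M: "poset_law M"
  shows "conv_distr_PL N M \<longleftrightarrow> (\<forall>A q. fin_poset (A, q) \<longrightarrow>
    (\<lambda>n. measure (N n) (ext_event A q)) \<longlonglongrightarrow> measure M (ext_event A q))"
proof (intro iffI allI impI)
  fix A q assume conv: "conv_distr_PL N M" and Q: "fin_poset (A, q)"
  let ?f = "indicator (ext_event A q) :: _ \<Rightarrow> real"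
  have "finite A" using Q by (rule fin_poset_finite)
  then have "continuous_on PL ?f"
    by (intro continuous_on_indicator_clopen) (simp_all add: ext_event_cyl open_cyl closed_cyl finite_ext)
  moreover have "bounded (?f ` PL)"
    by (rule boundedI[of _ 1]) auto
  ultimately have "(\<lambda>n. LINT x:PL|N n. ?f x) \<longlonglongrightarrow> (LINT x:PL|M. ?f x)"
    using conv by (simp add: conv_distr_PL_def)
  then show "(\<lambda>n. measure (N n) (ext_event A q)) \<longlonglongrightarrow> measure M (ext_event A q)"
    using borel_ext_event[OF \<open>finite A\<close>]
    by (simp add: poset_law_integral_indicator[OF N] poset_law_integral_indicator[OF M])
next
  assume "\<forall>A q. fin_poset (A, q) \<longrightarrow>
    (\<lambda>n. measure (N n) (ext_event A q)) \<longlonglongrightarrow> measure M (ext_event A q)"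
  then show "conv_distr_PL N M"
    unfolding conv_distr_PL_def
    by (intro allI impI poset_law_integral_tendsto always_eventually N M) auto
qed

theorem theorem1p17:
  fixes P :: "nat \<Rightarrow> fposet"
  assumes fin: "\<And>n. fin_poset (P n)"
    and size: "filterlim (\<lambda>n. card (fst (P n))) at_top sequentially"
  shows "((\<exists>Lm\<in>Pbar. (\<lambda>n. emb (P n)) \<longlonglongrightarrow> Lm) \<longleftrightarrow>
           (\<exists>M. random_poset_law M \<and> conv_distr_PL (\<lambda>n. hat_law (P n)) M))
       \<and> (\<forall>Lm M. Lm \<in> Pbar \<longrightarrow> (\<lambda>n. emb (P n)) \<longlonglongrightarrow> Lm \<longrightarrow>
            random_poset_law M \<longrightarrow> conv_distr_PL (\<lambda>n. hat_law (P n)) M \<longrightarrow>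
            exchangeable M
          \<and> (\<forall>(mu :: 'a measure) prec W. is_kernel mu prec W \<longrightarrow> Pi_W mu W = Lm \<longrightarrow>
               M = P_inf_law mu W)
          \<and> (\<forall>A q. fin_poset (A, q) \<longrightarrow>
               hom_dens_bar (A, q) Lm = measure M {R. \<forall>x\<in>A. \<forall>y\<in>A. q x y \<longrightarrow> R x y})
          \<and> (\<forall>A q. fin_poset (A, q) \<longrightarrow>
               ind_dens_bar (A, q) Lm = measure M {R. \<forall>x\<in>A. \<forall>y\<in>A. R x y \<longleftrightarrow> q x y}))"
proof (intro conjI allI impI)
  note ev = always_eventually[OF allI[OF fin]]
  note hat = poset_law_hat_law[OF fin]
  have distr_iff: "conv_distr_PL (\<lambda>n. hat_law (P n)) M \<longleftrightarrow> (\<forall>A q. fin_poset (A, q) \<longrightarrow>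
      (\<lambda>n. measure (hat_law (P n)) (ext_event A q)) \<longlonglongrightarrow> measure M (ext_event A q))"
    if "random_poset_law M" for M
    using that by (intro conv_distr_PL_iff hat) (simp add: random_poset_law_iff)
  have snd_0: "(\<lambda>n. snd (emb (P n))) \<longlonglongrightarrow> 0"
    using tendsto_inverse_0_at_top[OF filterlim_compose[OF filterlim_real_sequentially size]]
    by (simp add: emb_def inverse_eq_divide)
  show "(\<exists>Lm\<in>Pbar. (\<lambda>n. emb (P n)) \<longlonglongrightarrow> Lm) \<longleftrightarrow>
      (\<exists>M. random_poset_law M \<and> conv_distr_PL (\<lambda>n. hat_law (P n)) M)"
  proof (intro iffI; (elim bexE exE conjE)?)
    fix Lm assume "(\<lambda>n. emb (P n)) \<longlonglongrightarrow> Lm"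
    from emb_tendsto_hat_law[OF ev size this]
    have "convergent (\<lambda>n. measure (hat_law (P n)) (ext_event A q))" if "fin_poset (A, q)" for A q
      using that by (auto simp: convergent_def)
    from poset_law_exists_limit[OF hat this] obtain M where "random_poset_law M"
        "\<forall>A q. fin_poset (A, q) \<longrightarrow>
          (\<lambda>n. measure (hat_law (P n)) (ext_event A q)) \<longlonglongrightarrow> measure M (ext_event A q)"
      by blast
    then show "\<exists>M. random_poset_law M \<and> conv_distr_PL (\<lambda>n. hat_law (P n)) M"
      using distr_iff by blast
  next
    fix M assume M: "random_poset_law M" "conv_distr_PL (\<lambda>n. hat_law (P n)) M"
    \<comment> \<open>The candidate limit: zeros off posets agree with \<open>emb\<close>, and the
      last 0 is the limit of \<open>1/|P n|\<close>.\<close>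
    define Lm where "Lm = (\<lambda>Q. if fin_poset Q then measure M (ext_event (fst Q) (snd Q)) else 0, 0 :: real)"
    have "(\<lambda>n. fst (emb (P n)) Q) \<longlonglongrightarrow> fst Lm Q" for Q
    proof (cases "fin_poset Q")
      case True
      then have "fin_poset (fst Q, snd Q)" by simp
      with M distr_iff have "(\<lambda>n. measure (hat_law (P n)) (ext_event (fst Q) (snd Q)))
          \<longlonglongrightarrow> measure M (ext_event (fst Q) (snd Q))" by blast
      then have "(\<lambda>n. hom_dens (fst Q, snd Q) (P n)) \<longlonglongrightarrow> measure M (ext_event (fst Q) (snd Q))"
        using hat_law_hom_dens_tendsto[OF ev size fin_poset_finite[of "fst Q" "snd Q"]] True by simp
      with True show ?thesis by (simp add: emb_def Lm_def)
    qed (simp add: emb_def Lm_def)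
    then have "(\<lambda>n. fst (emb (P n))) \<longlonglongrightarrow> fst Lm" by (simp add: tendsto_fun_iff)
    moreover have "(\<lambda>n. snd (emb (P n))) \<longlonglongrightarrow> snd Lm" using snd_0 by (simp add: Lm_def)
    ultimately have lim: "(\<lambda>n. emb (P n)) \<longlonglongrightarrow> Lm"
      using tendsto_Pair by fastforce
    have "emb (P n) \<in> Pbar" for n
      unfolding Pbar_def using fin[of n] by (intro subsetD[OF closure_subset]) simp
    then have "Lm \<in> Pbar"
      unfolding Pbar_def by (intro Lim_in_closed_set[OF closed_closure _ _ lim]) auto
    with lim show "\<exists>Lm\<in>Pbar. (\<lambda>n. emb (P n)) \<longlonglongrightarrow> Lm" by blast
  qed
  fix Lm M
  assume Lm: "Lm \<in> Pbar" "(\<lambda>n. emb (P n)) \<longlonglongrightarrow> Lm"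
    and M: "random_poset_law M" and conv: "conv_distr_PL (\<lambda>n. hat_law (P n)) M"
  have M': "poset_law M" "sets M = sets borel" using M by (simp_all add: random_poset_law_iff)
  have lim: "(\<lambda>n. measure (hat_law (P n)) (ext_event A q)) \<longlonglongrightarrow> measure M (ext_event A q)"
    if "fin_poset (A, q)" for A q
    using conv that by (simp add: distr_iff[OF M])
  have meas: "measure M (ext_event A q) = fst Lm (A, q)" if "fin_poset (A, q)" for A q
    using lim[OF that] emb_tendsto_hat_law[OF ev size Lm(2) that] by (rule LIMSEQ_unique)
  have snd_Lm: "snd Lm = 0"
    using tendsto_snd[OF Lm(2)] snd_0 by (rule LIMSEQ_unique)
  show "exchangeable M" using fin size M lim by (rule exchangeable_limit)
  show "M = P_inf_law mu W" if W: "is_kernel mu prec W" "Pi_W mu W = Lm"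
    for mu :: "'a measure" and prec W
  \<comment> \<open>Both laws have the coordinates of \<open>Lm\<close> as extension
    probabilities.\<close>
  proof (rule poset_law_eqI[OF M' poset_law_P_inf_law[OF W(1)]])
    show "measure M (ext_event A q) = measure (P_inf_law mu W) (ext_event A q)"
      if "fin_poset (A, q)" for A q
      using meas[OF that] measure_P_inf_law_ext_event[OF W(1) that] W(2) by simp
  qed (simp add: P_inf_law_def)
  show "hom_dens_bar (A, q) Lm = measure M {R. \<forall>x\<in>A. \<forall>y\<in>A. q x y \<longrightarrow> R x y}"
    if "fin_poset (A, q)" for A q
    using meas[OF that] by (simp add: hom_dens_bar_def ext_event_def)
  show "ind_dens_bar (A, q) Lm = measure M {R. \<forall>x\<in>A. \<forall>y\<in>A. R x y \<longleftrightarrow> q x y}"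
    if "fin_poset (A, q)" for A q
    using Lm(1) snd_Lm M'(1) fin_poset_finite[OF that] meas by (rule ind_dens_bar_eq_measure)
qed

end
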